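(* Let $(\mathscr{A},\phi)$ be a $C^\ast$-probability space, and let $\gamma$ and $\lambda$ be positive constants. There exists an $\mathscr{R}$-diagonal element $b=b_{\gamma,\lambda}\in\mathscr{A}$ with \[ \alpha_n[b]=\beta_n[b]=\gamma\cdot\lambda^{2n} . \]
   Context: A $C^\ast$-probability space is a unital $C^\ast$-algebra $\mathscr{A}$ with a faithful state $\phi$. Free cumulants $\kappa_n$ are the multilinear functionals determined by $\phi(x_1\cdots x_n)=\sum_{\pi\in NC(n)}\prod_{V\in\pi}\kappa_{|V|}[x_i:i\in V]$ (arguments in increasing order), where $NC(n)$ is the set of non-crossing partitions of $\{1,\dots,n\}$. An element $b$ is $\mathscr{R}$-diagonal if its only non-vanishing free cumulants with arguments in $\{b,b^\ast\}$ are the alternating ones of even length; its determining sequences are $\alpha_n[b]=\kappa_{2n}[b,b^\ast,\dots,b,b^\ast]$ and $\beta_n[b]=\kappa_{2n}[b^\ast,b,\dots,b^\ast,b]$, $n\ge1$.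
   Formalization: The claim fails for an arbitrary C*-probability space (in the complex numbers an R-diagonal b is 0, so α_1 = 0); proved instead: there exists one C*-probability space containing such an element b for all positive γ and λ. *)

theory Defs
  imports "HOL-Analysis.Analysis" "HOL-Algebra.Module" "HOL-Library.Disjoint_Sets"
begin

definition complex_field_ring :: "complex ring" where
  "complex_field_ring = \<lparr>carrier = UNIV, mult = (*), one = 1, zero = 0, add = (+)\<rparr>"

record 'a cstar_structure = "(complex, 'a) module" +
  star :: "'a \<Rightarrow> 'a"
  nrm :: "'a \<Rightarrow> real"

text \<open>The locale for algebras in HOL-Algebra is restricted to commutative algebras, so the
  compatibility of scalars with the product is stated directly.\<close>

locale cstar_algebra = ring A for A :: "'a cstar_structure" (structure) +
  assumes module: "module complex_field_ring A"
    and smult_mult_left: "\<lbrakk>x \<in> carrier A; y \<in> carrier A\<rbrakk> \<Longrightarrow> (c \<odot> x) \<otimes> y = c \<odot> (x \<otimes> y)"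
    and smult_mult_right: "\<lbrakk>x \<in> carrier A; y \<in> carrier A\<rbrakk> \<Longrightarrow> x \<otimes> (c \<odot> y) = c \<odot> (x \<otimes> y)"
    and star_closed: "x \<in> carrier A \<Longrightarrow> star A x \<in> carrier A"
    and star_star: "x \<in> carrier A \<Longrightarrow> star A (star A x) = x"
    and star_add: "\<lbrakk>x \<in> carrier A; y \<in> carrier A\<rbrakk> \<Longrightarrow> star A (x \<oplus> y) = star A x \<oplus> star A y"
    and star_smult: "x \<in> carrier A \<Longrightarrow> star A (c \<odot> x) = cnj c \<odot> star A x"
    and star_mult: "\<lbrakk>x \<in> carrier A; y \<in> carrier A\<rbrakk> \<Longrightarrow> star A (x \<otimes> y) = star A y \<otimes> star A x"
    and nrm_nonneg: "x \<in> carrier A \<Longrightarrow> 0 \<le> nrm A x"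
    and nrm_eq_0_iff: "x \<in> carrier A \<Longrightarrow> nrm A x = 0 \<longleftrightarrow> x = \<zero>"
    and nrm_triangle: "\<lbrakk>x \<in> carrier A; y \<in> carrier A\<rbrakk> \<Longrightarrow> nrm A (x \<oplus> y) \<le> nrm A x + nrm A y"
    and nrm_smult: "x \<in> carrier A \<Longrightarrow> nrm A (c \<odot> x) = cmod c * nrm A x"
    and nrm_mult: "\<lbrakk>x \<in> carrier A; y \<in> carrier A\<rbrakk> \<Longrightarrow> nrm A (x \<otimes> y) \<le> nrm A x * nrm A y"
    and cstar_identity: "x \<in> carrier A \<Longrightarrow> nrm A (star A x \<otimes> x) = (nrm A x)\<^sup>2"
    and complete: "\<lbrakk>\<And>n::nat. X n \<in> carrier A;
        \<And>e. 0 < e \<Longrightarrow> \<exists>N. \<forall>m\<ge>N. \<forall>n\<ge>N. nrm A (X m \<ominus> X n) < e\<rbrakk>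
        \<Longrightarrow> \<exists>x\<in>carrier A. (\<lambda>n. nrm A (X n \<ominus> x)) \<longlonglongrightarrow> 0"

locale cstar_probability_space = cstar_algebra A
  for A :: "'a cstar_structure" (structure) and \<phi> :: "'a \<Rightarrow> complex" +
  assumes state_add: "\<lbrakk>x \<in> carrier A; y \<in> carrier A\<rbrakk> \<Longrightarrow> \<phi> (x \<oplus> y) = \<phi> x + \<phi> y"
    and state_smult: "x \<in> carrier A \<Longrightarrow> \<phi> (c \<odot> x) = c * \<phi> x"
    and state_one: "\<phi> \<one> = 1"
    and state_positive: "x \<in> carrier A \<Longrightarrow> \<phi> (star A x \<otimes> x) \<in> \<real>\<^sub>\<ge>\<^sub>0"
    and state_faithful: "\<lbrakk>x \<in> carrier A; \<phi> (star A x \<otimes> x) = 0\<rbrakk> \<Longrightarrow> x = \<zero>"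

text \<open>Partitions are taken of \<open>{0,\<dots>,n-1}\<close> instead of \<open>{1,\<dots>,n}\<close>, to match list positions.\<close>

definition noncrossing :: "nat set set \<Rightarrow> bool" where
  "noncrossing P \<longleftrightarrow>
     \<not> (\<exists>V\<in>P. \<exists>W\<in>P. V \<noteq> W \<and> (\<exists>i j k l. i < j \<and> j < k \<and> k < l \<and> i \<in> V \<and> k \<in> V \<and> j \<in> W \<and> l \<in> W))"

definition NC :: "nat \<Rightarrow> nat set set set" where
  "NC n = {P. partition_on {..<n} P \<and> noncrossing P}"

lemma finite_NC [simp]: "finite (NC n)"
proof (rule finite_subset)
  show "NC n \<subseteq> Pow (Pow {..<n})"
    by (auto simp: NC_def partition_on_def)
qed simp

lemma length_nths_less:
  assumes "P \<in> NC n - {{{..<n}}}" "V \<in> P" "n = length xs"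
  shows "length (nths xs V) < length xs"
proof -
  have P: "partition_on {..<n} P" "P \<noteq> {{..<n}}"
    using assms(1) by (auto simp: NC_def)
  have "V \<noteq> {..<n}"
  proof
    assume V: "V = {..<n}"
    have "W = V" if "W \<in> P" for W
    proof (rule ccontr)
      assume "W \<noteq> V"
      then have "W \<inter> V = {}"
        using P(1) that assms(2) by (auto simp: partition_on_def dest: disjointD)
      moreover have "W \<subseteq> V" "W \<noteq> {}"
        using P(1) that V by (auto simp: partition_on_def)
      ultimately show False by blast
    qed
    then have "P = {{..<n}}" using V assms(2) by blast
    with P(2) show False by simp
  qed
  moreover have "V \<subseteq> {..<n}"
    using P(1) assms(2) by (auto simp: partition_on_def)
  ultimately have "card {i. i < n \<and> i \<in> V} < card {..<n}"
    by (intro psubset_card_mono) auto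
  then show ?thesis
    by (simp add: length_nths assms(3))
qed

definition list_product :: "'a cstar_structure \<Rightarrow> 'a list \<Rightarrow> 'a" where
  "list_product A xs = foldr (mult A) xs (one A)"

text \<open>\<open>free_cumulant A \<phi> [x\<^sub>1, \<dots>, x\<^sub>n]\<close> is \<open>\<kappa>\<^sub>n[x\<^sub>1, \<dots>, x\<^sub>n]\<close>: the moment-cumulant formula is solved
  for the term of the one-block partition, all other blocks being shorter. The formula itself
  is \<open>moment_cumulant\<close> below. The sublist \<open>nths xs V\<close> keeps the entries at positions in \<open>V\<close>,
  in increasing order.\<close>

function free_cumulant :: "'a cstar_structure \<Rightarrow> ('a \<Rightarrow> complex) \<Rightarrow> 'a list \<Rightarrow> complex" where
  "free_cumulant A \<phi> xs =
     \<phi> (list_product A xs)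
       - (\<Sum>P\<in>NC (length xs) - {{{..<length xs}}}. \<Prod>V\<in>P. free_cumulant A \<phi> (nths xs V))"
  by pat_completeness auto
termination
  by (relation "Wellfounded.measure (\<lambda>(A, \<phi>, xs). length xs)") (simp_all add: length_nths_less)

declare free_cumulant.simps [simp del]

lemma moment_cumulant:
  assumes "xs \<noteq> []"
  shows "\<phi> (list_product A xs) =
    (\<Sum>P\<in>NC (length xs). \<Prod>V\<in>P. free_cumulant A \<phi> (nths xs V))"
proof -
  let ?n = "length xs"
  have "{{..<?n}} \<in> NC ?n"
    using assms by (auto simp: NC_def noncrossing_def partition_on_def disjoint_def)
  then have "(\<Sum>P\<in>NC ?n. \<Prod>V\<in>P. free_cumulant A \<phi> (nths xs V)) =
      free_cumulant A \<phi> (nths xs {..<?n})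
      + (\<Sum>P\<in>NC ?n - {{{..<?n}}}. \<Prod>V\<in>P. free_cumulant A \<phi> (nths xs V))"
    by (subst sum.remove[of _ "{{..<?n}}"]) auto
  then show ?thesis
    by (simp add: free_cumulant.simps[of A \<phi> xs])
qed

text \<open>Words in \<open>b, b\<^sup>*\<close> are encoded by lists of Booleans, with \<open>True\<close> for \<open>b\<close>, so that
  alternation refers to the formal word.\<close>

definition star_word :: "'a cstar_structure \<Rightarrow> 'a \<Rightarrow> bool list \<Rightarrow> 'a list" where
  "star_word A b w = map (\<lambda>s. if s then b else star A b) w"

definition R_diagonal :: "'a cstar_structure \<Rightarrow> ('a \<Rightarrow> complex) \<Rightarrow> 'a \<Rightarrow> bool" where
  "R_diagonal A \<phi> b \<longleftrightarrow> b \<in> carrier A \<and>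
     (\<forall>w. w \<noteq> [] \<and> \<not> (even (length w) \<and> distinct_adj w) \<longrightarrow> free_cumulant A \<phi> (star_word A b w) = 0)"

definition alpha_seq :: "'a cstar_structure \<Rightarrow> ('a \<Rightarrow> complex) \<Rightarrow> 'a \<Rightarrow> nat \<Rightarrow> complex" where
  "alpha_seq A \<phi> b n = free_cumulant A \<phi> (concat (replicate n [b, star A b]))"

definition beta_seq :: "'a cstar_structure \<Rightarrow> ('a \<Rightarrow> complex) \<Rightarrow> 'a \<Rightarrow> nat \<Rightarrow> complex" where
  "beta_seq A \<phi> b n = free_cumulant A \<phi> (concat (replicate n [star A b, b]))"

text \<open>C*-algebras are carried by subsets of a type, and HOL cannot quantify existentially over
  types. This type is only a host for carriers: it has room for all operators on
  \<open>\<ell>\<^sup>2\<close> of the finite words over an alphabet of continuum size.\<close>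

type_synonym host = "(real list \<Rightarrow> complex) \<Rightarrow> (real list \<Rightarrow> complex)"

end

(* A compound Poisson construction on a full Fock space. The one-particle space is the orthogonal
   sum over real t of copies of the 2x2 matrices with the Hilbert-Schmidt inner product. For a matrix
   unit a of the t-th copy put X(a) = l(xi a) + l(xi a^* )^* + Lambda(a), where l creates a letter on
   the left, Lambda(a) multiplies the first letter by a, and xi = exp t. Its cumulants with respect
   to the vacuum are xi^2 Tr(a_1 ... a_n), so X(e_12) has the alternating cumulants of even length
   equal to xi^2 and all others equal to zero; the factor lam only rescales.

   The vacuum is not faithful on all operators. The carrier consists of the adjointable operators
   that commute with the mirror images of the X(a), which act on the last letter. These commute
   with every X(a) and reach the whole space from the vacuum, so the vacuum separates their
   commutant. All values of gamma live in this one algebra; no relation between different t is needed.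

   The moment-cumulant formula follows since both sides obey the same recursion. For noncrossing
   partitions, one follows the block of the first element to its next element; for the operators,
   one follows a letter on the stack to the next operator that touches it. *)
theory Submission
  imports Defs
begin

section \<open>The Hilbert space of square summable functions\<close>

typedef 'a ell2 = "{f :: 'a \<Rightarrow> complex. (\<lambda>x. (norm (f x))\<^sup>2) summable_on UNIV}"
  morphisms coord Abs_ell2
  by (rule exI[of _ "\<lambda>_. 0"]) simp

setup_lifting type_definition_ell2

lemma ell2_eqI: "(\<And>x. coord f x = coord g x) \<Longrightarrow> f = g"
  by (simp add: coord_inject[symmetric] fun_eq_iff)

lemma summable_coord: "(\<lambda>x. (norm (coord f x))\<^sup>2) summable_on UNIV"
  using coord[of f] by simp

lemma square_summable_add:
  fixes f g :: "'a \<Rightarrow> complex"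
  assumes "(\<lambda>x. (norm (f x))\<^sup>2) summable_on UNIV" "(\<lambda>x. (norm (g x))\<^sup>2) summable_on UNIV"
  shows "(\<lambda>x. (norm (f x + g x))\<^sup>2) summable_on UNIV"
proof (rule summable_on_comparison_test)
  show "(\<lambda>x. 2 * (norm (f x))\<^sup>2 + 2 * (norm (g x))\<^sup>2) summable_on UNIV"
    by (intro summable_on_add summable_on_cmult_right assms)
  fix x
  have "(norm (f x + g x))\<^sup>2 \<le> (norm (f x) + norm (g x))\<^sup>2"
    by (intro power_mono norm_triangle_ineq) simp
  also have "\<dots> \<le> 2 * (norm (f x))\<^sup>2 + 2 * (norm (g x))\<^sup>2"
    using sum_squares_bound[of "norm (f x)" "norm (g x)"] by (simp add: power2_sum)
  finally show "(norm (f x + g x))\<^sup>2 \<le> 2 * (norm (f x))\<^sup>2 + 2 * (norm (g x))\<^sup>2" .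
qed simp

lemma square_summable_mult:
  fixes f :: "'a \<Rightarrow> complex"
  assumes "(\<lambda>x. (norm (f x))\<^sup>2) summable_on UNIV"
  shows "(\<lambda>x. (norm (c * f x))\<^sup>2) summable_on UNIV"
  unfolding norm_mult power_mult_distrib by (intro summable_on_cmult_right assms)

lemma summable_inner_coord: "(\<lambda>x. inner (coord f x) (coord g x)) summable_on UNIV"
proof (rule abs_summable_summable, rule summable_on_comparison_test)
  show "(\<lambda>x. (norm (coord f x))\<^sup>2 + (norm (coord g x))\<^sup>2) summable_on UNIV"
    by (intro summable_on_add summable_coord)
  fix x
  have "norm (inner (coord f x) (coord g x)) \<le> norm (coord f x) * norm (coord g x)"
    using Cauchy_Schwarz_ineq2 by (simp add: real_norm_def)
  also have "\<dots> \<le> (norm (coord f x))\<^sup>2 + (norm (coord g x))\<^sup>2"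
    using sum_squares_bound[of "norm (coord f x)" "norm (coord g x)"]
      mult_nonneg_nonneg[OF norm_ge_zero[of "coord f x"] norm_ge_zero[of "coord g x"]] by linarith
  finally show "norm (inner (coord f x) (coord g x)) \<le> (norm (coord f x))\<^sup>2 + (norm (coord g x))\<^sup>2" .
qed simp

lift_definition scaleC :: "complex \<Rightarrow> 'a ell2 \<Rightarrow> 'a ell2" is "\<lambda>c f x. c * f x"
  by (simp add: square_summable_mult)

instantiation ell2 :: (type) real_inner
begin

lift_definition zero_ell2 :: "'a ell2" is "\<lambda>_. 0" by simp
lift_definition plus_ell2 :: "'a ell2 \<Rightarrow> 'a ell2 \<Rightarrow> 'a ell2" is "\<lambda>f g x. f x + g x"
  by (simp add: square_summable_add)
lift_definition uminus_ell2 :: "'a ell2 \<Rightarrow> 'a ell2" is "\<lambda>f x. - f x" by simp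
definition minus_ell2 :: "'a ell2 \<Rightarrow> 'a ell2 \<Rightarrow> 'a ell2" where "f - g = f + - g" for f g :: "'a ell2"
definition scaleR_ell2 :: "real \<Rightarrow> 'a ell2 \<Rightarrow> 'a ell2" where "scaleR_ell2 r = scaleC (of_real r)"
text \<open>On complex numbers \<open>inner\<close> is the real part of the Hermitian product, so
  this is the real part of the usual inner product. Complex linearity is recovered later by
  commuting with \<open>scaleC\<close>.\<close>

definition inner_ell2 :: "'a ell2 \<Rightarrow> 'a ell2 \<Rightarrow> real" where
  "inner_ell2 f g = (\<Sum>\<^sub>\<infinity>x. inner (coord f x) (coord g x))"
definition norm_ell2 :: "'a ell2 \<Rightarrow> real" where "norm_ell2 f = sqrt (inner f f)"
definition dist_ell2 :: "'a ell2 \<Rightarrow> 'a ell2 \<Rightarrow> real" where "dist f g = norm (f - g)" for f g :: "'a ell2"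
definition sgn_ell2 :: "'a ell2 \<Rightarrow> 'a ell2" where "sgn f = scaleR (inverse (norm f)) f" for f :: "'a ell2"
definition uniformity_ell2 :: "('a ell2 \<times> 'a ell2) filter" where
  "uniformity_ell2 = (INF e\<in>{0<..}. principal {(x, y). dist x y < e})"
definition open_ell2 :: "'a ell2 set \<Rightarrow> bool" where
  "open_ell2 U = (\<forall>x\<in>U. \<forall>\<^sub>F (x', y) in uniformity. x' = x \<longrightarrow> y \<in> U)"

instance
proof
  fix f g h :: "'a ell2" and a b :: real
  show "f + g + h = f + (g + h)" "f + g = g + f" "0 + f = f" "- f + f = 0"
    by (transfer, auto simp: algebra_simps)+
  show "f - g = f + - g" by (rule minus_ell2_def)
  show "a *\<^sub>R (f + g) = a *\<^sub>R f + a *\<^sub>R g" "(a + b) *\<^sub>R f = a *\<^sub>R f + b *\<^sub>R f"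
    "a *\<^sub>R b *\<^sub>R f = (a * b) *\<^sub>R f" "1 *\<^sub>R f = f"
    unfolding scaleR_ell2_def by (transfer, auto simp: algebra_simps)+
  show "dist f g = norm (f - g)" by (rule dist_ell2_def)
  show "sgn f = inverse (norm f) *\<^sub>R f" by (rule sgn_ell2_def)
  show "uniformity = (INF e\<in>{0<..}. principal {(x, y :: 'a ell2). dist x y < e})"
    by (rule uniformity_ell2_def)
  show "norm f = sqrt (inner f f)" by (rule norm_ell2_def)
  show "inner f g = inner g f" by (simp add: inner_ell2_def inner_commute)
  show "inner (f + g) h = inner f h + inner g h"
    by (simp add: inner_ell2_def plus_ell2.rep_eq inner_add_left summable_inner_coord infsum_add)
  show "inner (a *\<^sub>R f) g = a * inner f g"
    by (simp add: inner_ell2_def scaleR_ell2_def scaleC.rep_eq infsum_cmult_right'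
        flip: scaleR_conv_of_real)
  show "0 \<le> inner f f" by (simp add: inner_ell2_def infsum_nonneg)
  show "inner f f = 0 \<longleftrightarrow> f = 0"
  proof
    assume "inner f f = 0"
    then have "inner (coord f x) (coord f x) = 0" for x
      unfolding inner_ell2_def
      by (intro nonneg_infsum_le_0D[of "\<lambda>x. inner (coord f x) (coord f x)" UNIV])
         (auto simp: summable_inner_coord)
    then show "f = 0" by (intro ell2_eqI) (simp add: zero_ell2.rep_eq)
  qed (simp add: inner_ell2_def zero_ell2.rep_eq)
qed (simp add: open_ell2_def)

end

lemma coord_simps [simp]:
  "coord 0 x = 0" "coord (f + g) x = coord f x + coord g x" "coord (- f) x = - coord f x"
  "coord (f - g) x = coord f x - coord g x" "coord (scaleC c f) x = c * coord f x"
  "coord (r *\<^sub>R f) x = r * coord f x"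
  by (simp_all only: zero_ell2.rep_eq plus_ell2.rep_eq uminus_ell2.rep_eq diff_conv_add_uminus
      scaleC.rep_eq scaleR_ell2_def)

lemma norm_ell2_square: "(norm f)\<^sup>2 = (\<Sum>\<^sub>\<infinity>x. (norm (coord f x))\<^sup>2)"
  unfolding power2_norm_eq_inner[of f] inner_ell2_def by (simp only: dot_square_norm)

lemma sum_coord_le_norm: "finite F \<Longrightarrow> (\<Sum>x\<in>F. (norm (coord f x))\<^sup>2) \<le> (norm f)\<^sup>2"
  unfolding norm_ell2_square by (rule finite_sum_le_infsum) (simp_all add: summable_coord)

lemma norm_coord_le: "norm (coord f x) \<le> norm f"
proof (rule power2_le_imp_le[OF _ norm_ge_zero])
  have "(norm (coord f x))\<^sup>2 = (\<Sum>y\<in>{x}. (norm (coord f y))\<^sup>2)" by simp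
  also have "\<dots> \<le> (norm f)\<^sup>2" by (rule sum_coord_le_norm) simp
  finally show "(norm (coord f x))\<^sup>2 \<le> (norm f)\<^sup>2" .
qed

instance ell2 :: (type) complete_space
proof
  fix X :: "nat \<Rightarrow> 'a ell2"
  assume X: "Cauchy X"
  have "Cauchy (\<lambda>n. coord (X n) x)" for x
  proof (rule CauchyI)
    fix e :: real assume "0 < e"
    with X obtain M where M: "\<forall>m\<ge>M. \<forall>n\<ge>M. norm (X m - X n) < e" by (metis CauchyD)
    have "norm (coord (X m) x - coord (X n) x) < e" if "m \<ge> M" "n \<ge> M" for m n
      using le_less_trans[OF norm_coord_le[of "X m - X n" x]] M that by simp
    then show "\<exists>M. \<forall>m\<ge>M. \<forall>n\<ge>M. norm (coord (X m) x - coord (X n) x) < e" by blast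
  qed
  then have "\<forall>x. \<exists>l. (\<lambda>n. coord (X n) x) \<longlonglongrightarrow> l"
    by (simp add: Cauchy_convergent_iff convergent_def)
  then obtain L where L: "\<And>x. (\<lambda>n. coord (X n) x) \<longlonglongrightarrow> L x" by metis
  \<comment> \<open>Square summability of \<open>L\<close> is still open, so the Cauchy bound passes
    to the limit on finite sets, uniformly in the set.\<close>
  have close: "\<exists>M. \<forall>m\<ge>M. \<forall>F. finite F \<longrightarrow> (\<Sum>x\<in>F. (norm (coord (X m) x - L x))\<^sup>2) \<le> e\<^sup>2"
    if e: "0 < e" for e
  proof -
    from X e obtain M where M: "\<forall>m\<ge>M. \<forall>n\<ge>M. norm (X m - X n) < e" by (metis CauchyD)
    have "(\<Sum>x\<in>F. (norm (coord (X m) x - L x))\<^sup>2) \<le> e\<^sup>2" if "m \<ge> M" "finite F" for m F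
    proof (rule tendsto_upperbound)
      show "(\<lambda>n. \<Sum>x\<in>F. (norm (coord (X m) x - coord (X n) x))\<^sup>2) \<longlonglongrightarrow>
          (\<Sum>x\<in>F. (norm (coord (X m) x - L x))\<^sup>2)"
        by (intro tendsto_intros L)
      have "(\<Sum>x\<in>F. (norm (coord (X m) x - coord (X n) x))\<^sup>2) \<le> e\<^sup>2" if "n \<ge> M" for n
      proof -
        have "norm (X m - X n) \<le> e" using M \<open>m \<ge> M\<close> that by (simp add: less_imp_le)
        from power_mono[OF this norm_ge_zero, of 2] show ?thesis
          using sum_coord_le_norm[OF \<open>finite F\<close>, of "X m - X n"] by simp
      qed
      then show "\<forall>\<^sub>F n in sequentially. (\<Sum>x\<in>F. (norm (coord (X m) x - coord (X n) x))\<^sup>2) \<le> e\<^sup>2"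
        by (auto simp: eventually_sequentially)
    qed simp
    then show ?thesis by blast
  qed
  have diff: "(\<lambda>x. (norm (coord (X m) x - L x))\<^sup>2) summable_on UNIV"
    if "\<And>F. finite F \<Longrightarrow> (\<Sum>x\<in>F. (norm (coord (X m) x - L x))\<^sup>2) \<le> e\<^sup>2" for m and e :: real
    by (rule nonneg_bdd_above_summable_on) (use that in \<open>auto simp: bdd_above_def\<close>)
  obtain M where "\<And>F. finite F \<Longrightarrow> (\<Sum>x\<in>F. (norm (coord (X M) x - L x))\<^sup>2) \<le> 1\<^sup>2"
    using close[of 1] by auto
  \<comment> \<open>\<open>L\<close> is \<open>X M\<close> minus the square summable difference just
    bounded.\<close>
  from square_summable_add[OF summable_coord[of "X M"] square_summable_mult[OF diff[OF this], of "-1"]]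
  have "(\<lambda>x. (norm (L x))\<^sup>2) summable_on UNIV" by simp
  then have coord_L: "coord (Abs_ell2 L) = L" by (simp add: Abs_ell2_inverse)
  have "X \<longlonglongrightarrow> Abs_ell2 L"
  proof (rule LIMSEQ_I)
    fix e :: real assume "0 < e"
    then obtain M where M: "\<And>m F. m \<ge> M \<Longrightarrow> finite F \<Longrightarrow>
        (\<Sum>x\<in>F. (norm (coord (X m) x - L x))\<^sup>2) \<le> (e / 2)\<^sup>2"
      using close[of "e / 2"] by auto
    have "norm (X m - Abs_ell2 L) \<le> e / 2" if "m \<ge> M" for m
    proof (rule power2_le_imp_le)
      show "(norm (X m - Abs_ell2 L))\<^sup>2 \<le> (e / 2)\<^sup>2"
        unfolding norm_ell2_square using M[OF that] diff[OF M[OF that]]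
        by (intro infsum_le_finite_sums) (auto simp: coord_L)
    qed (use \<open>0 < e\<close> in simp)
    then show "\<exists>M. \<forall>m\<ge>M. norm (X m - Abs_ell2 L) < e"
      using \<open>0 < e\<close> by (intro exI[of _ M]) force
  qed
  then show "convergent X" by (auto simp: convergent_def)
qed

instance ell2 :: (type) banach ..

section \<open>Partial shifts and adjoints\<close>

text \<open>Creation, annihilation and relabelling of letters all move basis vectors along partial
  injections. One treatment of a mutually inverse pair gives boundedness and adjoints for all of
  them.\<close>

definition partial_inverse :: "('a \<Rightarrow> 'b option) \<Rightarrow> ('b \<Rightarrow> 'a option) \<Rightarrow> bool" where
  "partial_inverse p q \<longleftrightarrow> (\<forall>x y. p x = Some y \<longleftrightarrow> q y = Some x)"

lemma partial_inverse_sym: "partial_inverse p q \<Longrightarrow> partial_inverse q p"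
  by (auto simp: partial_inverse_def)

text \<open>Both sides sum \<open>F\<close> over the common graph of \<open>p\<close> and
  \<open>q\<close>. Working with \<open>has_sum\<close> yields summability and value
  together.\<close>

lemma has_sum_partial_inverse:
  fixes F :: "'a \<Rightarrow> 'b \<Rightarrow> real"
  assumes "partial_inverse p q"
  shows "((\<lambda>x. case p x of None \<Rightarrow> 0 | Some y \<Rightarrow> F x y) has_sum s) UNIV \<longleftrightarrow>
         ((\<lambda>y. case q y of None \<Rightarrow> 0 | Some x \<Rightarrow> F x y) has_sum s) UNIV"
proof -
  have pq: "p x = Some y \<longleftrightarrow> q y = Some x" for x y
    using assms by (simp add: partial_inverse_def)
  have "((\<lambda>x. case p x of None \<Rightarrow> 0 | Some y \<Rightarrow> F x y) has_sum s) UNIV \<longleftrightarrow>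
      ((\<lambda>x. F x (the (p x))) has_sum s) {x. p x \<noteq> None}"
    by (rule has_sum_cong_neutral) auto
  also have "\<dots> \<longleftrightarrow> ((\<lambda>y. F (the (q y)) y) has_sum s) {y. q y \<noteq> None}"
    by (rule has_sum_reindex_bij_witness[of _ "\<lambda>y. the (q y)" "\<lambda>x. the (p x)"])
       (auto simp: pq, (metis option.sel pq)+)
  also have "\<dots> \<longleftrightarrow> ((\<lambda>y. case q y of None \<Rightarrow> 0 | Some x \<Rightarrow> F x y) has_sum s) UNIV"
    by (rule has_sum_cong_neutral) auto
  finally show ?thesis .
qed

lemma
  fixes F :: "'a \<Rightarrow> 'b \<Rightarrow> real"
  assumes "partial_inverse p q"
  shows summable_on_partial_inverse:
      "(\<lambda>x. case p x of None \<Rightarrow> 0 | Some y \<Rightarrow> F x y) summable_on UNIV \<longleftrightarrow>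
       (\<lambda>y. case q y of None \<Rightarrow> 0 | Some x \<Rightarrow> F x y) summable_on UNIV"
    and infsum_partial_inverse:
      "(\<Sum>\<^sub>\<infinity>x. case p x of None \<Rightarrow> 0 | Some y \<Rightarrow> F x y) =
       (\<Sum>\<^sub>\<infinity>y. case q y of None \<Rightarrow> 0 | Some x \<Rightarrow> F x y)"
proof -
  note iff = has_sum_partial_inverse[OF assms, of F]
  then show *: "(\<lambda>x. case p x of None \<Rightarrow> 0 | Some y \<Rightarrow> F x y) summable_on UNIV \<longleftrightarrow>
       (\<lambda>y. case q y of None \<Rightarrow> 0 | Some x \<Rightarrow> F x y) summable_on UNIV"
    by (simp add: summable_on_def)
  show "(\<Sum>\<^sub>\<infinity>x. case p x of None \<Rightarrow> 0 | Some y \<Rightarrow> F x y) =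
       (\<Sum>\<^sub>\<infinity>y. case q y of None \<Rightarrow> 0 | Some x \<Rightarrow> F x y)"
    using iff * by (metis has_sum_infsum infsumI infsum_not_exists)
qed

definition pull :: "('a \<Rightarrow> 'b option) \<Rightarrow> ('b \<Rightarrow> complex) \<Rightarrow> 'a \<Rightarrow> complex" where
  "pull p f x = (case p x of None \<Rightarrow> 0 | Some y \<Rightarrow> f y)"

lemma norm_pull: "(norm (pull p f x))\<^sup>2 = (case p x of None \<Rightarrow> 0 | Some y \<Rightarrow> (norm (f y))\<^sup>2)"
  by (simp add: pull_def split: option.split)

lemma summable_pull:
  assumes "partial_inverse p q" "(\<lambda>x. (norm (f x))\<^sup>2) summable_on UNIV"
  shows "(\<lambda>x. (norm (pull p f x))\<^sup>2) summable_on UNIV"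
  unfolding norm_pull summable_on_partial_inverse[OF assms(1)]
  by (rule summable_on_comparison_test[OF assms(2)]) (auto split: option.split)

text \<open>This is composition with \<open>p\<close>; with an inverse \<open>q\<close>, it moves
  basis vectors along \<open>q\<close>, the direction opposite to \<open>p\<close>.\<close>

definition shift :: "('a \<Rightarrow> 'a option) \<Rightarrow> 'a ell2 \<Rightarrow>\<^sub>L 'a ell2" where
  "shift p = Blinfun (\<lambda>f. Abs_ell2 (pull p (coord f)))"

lemma coord_shift [simp]:
  assumes "partial_inverse p q"
  shows "coord (shift p f) = pull p (coord f)"
proof -
  let ?T = "\<lambda>f. Abs_ell2 (pull p (coord f))"
  have coord_T: "coord (?T f) = pull p (coord f)" for f
    using summable_pull[OF assms summable_coord[of f]] by (simp add: Abs_ell2_inverse)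
  have "bounded_linear ?T"
  proof (rule bounded_linear_intro[of _ 1])
    fix f g :: "'a ell2" and r :: real
    show "?T (f + g) = ?T f + ?T g" "?T (r *\<^sub>R f) = r *\<^sub>R ?T f"
      by (rule ell2_eqI, simp add: coord_T, simp add: pull_def split: option.split)+
    have "(norm (?T f))\<^sup>2 = (\<Sum>\<^sub>\<infinity>x. case q x of None \<Rightarrow> 0 | Some _ \<Rightarrow> (norm (coord f x))\<^sup>2)"
      unfolding norm_ell2_square coord_T norm_pull by (rule infsum_partial_inverse[OF assms])
    also have "\<dots> \<le> (norm f)\<^sup>2"
      unfolding norm_ell2_square
      by (intro infsum_mono summable_coord summable_on_comparison_test[OF summable_coord[of f]])
         (auto split: option.split)
    finally have "norm (?T f) \<le> norm f" by (rule power2_le_imp_le) simp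
    then show "norm (?T f) \<le> norm f * 1" by simp
  qed
  then show ?thesis by (simp add: shift_def bounded_linear_Blinfun_apply coord_T)
qed

section \<open>Adjoint pairs and the C*-identity\<close>

definition adjoint_pair ::
    "('a::real_inner \<Rightarrow>\<^sub>L 'a) \<Rightarrow> ('a \<Rightarrow>\<^sub>L 'a) \<Rightarrow> bool" where
  "adjoint_pair T S \<longleftrightarrow> (\<forall>f g. inner (T f) g = inner f (S g))"

lemma adjoint_pairD: "adjoint_pair T S \<Longrightarrow> inner (T f) g = inner f (S g)"
  by (simp add: adjoint_pair_def)

lemma adjoint_pair_sym: "adjoint_pair T S \<Longrightarrow> adjoint_pair S T"
  by (simp add: adjoint_pair_def) (metis inner_commute)

lemma adjoint_pair_unique: "adjoint_pair T S \<Longrightarrow> adjoint_pair T S' \<Longrightarrow> S = S'"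
  by (rule blinfun_eqI) (metis adjoint_pair_def vector_eq_ldot)

lemma adjoint_pair_id: "adjoint_pair id_blinfun id_blinfun"
  by (simp add: adjoint_pair_def)

lemma adjoint_pair_0: "adjoint_pair 0 0"
  by (simp add: adjoint_pair_def)

lemma adjoint_pair_add:
  "adjoint_pair T S \<Longrightarrow> adjoint_pair T' S' \<Longrightarrow> adjoint_pair (T + T') (S + S')"
  by (simp add: adjoint_pair_def blinfun.add_left inner_add_left inner_add_right)

lemma adjoint_pair_scaleR: "adjoint_pair T S \<Longrightarrow> adjoint_pair (r *\<^sub>R T) (r *\<^sub>R S)"
  by (simp add: adjoint_pair_def blinfun.scaleR_left)

lemma adjoint_pair_compose:
  "adjoint_pair T S \<Longrightarrow> adjoint_pair T' S' \<Longrightarrow> adjoint_pair (T o\<^sub>L T') (S' o\<^sub>L S)"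
  by (simp add: adjoint_pair_def)

lemma norm_adjoint_le:
  assumes "adjoint_pair T S"
  shows "norm S \<le> norm T"
proof (rule norm_blinfun_bound)
  fix f
  have "(norm (S f))\<^sup>2 = inner (T (S f)) f"
    using assms by (simp add: adjoint_pair_def power2_norm_eq_inner)
  also have "\<dots> \<le> norm (T (S f)) * norm f" by (rule norm_cauchy_schwarz)
  also have "\<dots> \<le> norm T * norm (S f) * norm f"
    by (intro mult_right_mono norm_blinfun) simp
  finally show "norm (S f) \<le> norm T * norm f"
    by (cases "S f = 0") (simp_all add: power2_eq_square)
qed simp

lemma norm_adjoint: "adjoint_pair T S \<Longrightarrow> norm S = norm T"
  by (intro antisym norm_adjoint_le) (simp_all add: adjoint_pair_sym)

text \<open>This is the C*-identity. The lower bound for the product comes from writing the square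
  of \<open>norm (T f)\<close> as the inner product of \<open>f\<close> with
  \<open>S (T f)\<close>.\<close>

lemma norm_adjoint_compose:
  assumes "adjoint_pair T S"
  shows "norm (S o\<^sub>L T) = (norm T)\<^sup>2"
proof (rule antisym)
  show "norm (S o\<^sub>L T) \<le> (norm T)\<^sup>2"
    using norm_blinfun_compose[of S T] by (simp add: norm_adjoint[OF assms] power2_eq_square)
  have "norm T \<le> sqrt (norm (S o\<^sub>L T))"
  proof (rule norm_blinfun_bound)
    fix f
    have "(norm (T f))\<^sup>2 = inner f ((S o\<^sub>L T) f)"
      using adjoint_pairD[OF assms, of f "T f"] by (simp add: power2_norm_eq_inner)
    also have "\<dots> \<le> norm f * norm ((S o\<^sub>L T) f)" by (rule norm_cauchy_schwarz)
    also have "\<dots> \<le> norm f * (norm (S o\<^sub>L T) * norm f)"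
      by (intro mult_left_mono norm_blinfun) simp
    also have "\<dots> = (sqrt (norm (S o\<^sub>L T)) * norm f)\<^sup>2"
      by (simp add: power2_eq_square algebra_simps)
    finally show "norm (T f) \<le> sqrt (norm (S o\<^sub>L T)) * norm f"
      by (rule power2_le_imp_le) simp
  qed simp
  then show "(norm T)\<^sup>2 \<le> norm (S o\<^sub>L T)"
    by (metis norm_ge_zero real_sqrt_pow2 power_mono)
qed

lemma adjoint_pair_shift:
  assumes "partial_inverse p q"
  shows "adjoint_pair (shift p) (shift q)"
proof -
  note pq = assms partial_inverse_sym[OF assms]
  have "inner (shift p f) g = inner f (shift q g)" for f g
  proof -
    have "inner (shift p f) g =
        (\<Sum>\<^sub>\<infinity>x. case p x of None \<Rightarrow> 0 | Some y \<Rightarrow> inner (coord f y) (coord g x))"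
      unfolding inner_ell2_def coord_shift[OF pq(1)]
      by (intro infsum_cong) (simp add: pull_def split: option.split)
    also have "\<dots> = (\<Sum>\<^sub>\<infinity>y. case q y of None \<Rightarrow> 0 | Some x \<Rightarrow> inner (coord f y) (coord g x))"
      by (rule infsum_partial_inverse[OF pq(1)])
    also have "\<dots> = inner f (shift q g)"
      unfolding inner_ell2_def coord_shift[OF pq(2)]
      by (intro infsum_cong) (simp add: pull_def split: option.split)
    finally show ?thesis .
  qed
  then show ?thesis by (simp add: adjoint_pair_def)
qed

section \<open>Complex scalars and basis vectors\<close>

lemma norm_scaleC: "norm (scaleC c f) = cmod c * norm f"
proof -
  have "(norm (scaleC c f))\<^sup>2 = (cmod c * norm f)\<^sup>2"
    by (simp add: norm_ell2_square norm_mult power_mult_distrib infsum_cmult_right')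
  then show ?thesis by (simp add: power2_eq_iff_nonneg)
qed

definition scalar :: "complex \<Rightarrow> 'a ell2 \<Rightarrow>\<^sub>L 'a ell2" where
  "scalar c = Blinfun (scaleC c)"

lemma scalar_apply [simp]: "scalar c f = scaleC c f"
proof -
  have "bounded_linear (scaleC c :: 'a ell2 \<Rightarrow> _)"
    by (rule bounded_linear_intro[of _ "cmod c"])
       (auto intro!: ell2_eqI simp: norm_scaleC algebra_simps)
  then show ?thesis by (simp add: scalar_def bounded_linear_Blinfun_apply)
qed

lemma adjoint_pair_scalar: "adjoint_pair (scalar c) (scalar (cnj c))"
  by (simp add: adjoint_pair_def inner_ell2_def inner_complex_def algebra_simps)

text \<open>For nonzero \<open>c\<close> the lower bound is the upper bound applied to
  \<open>inverse c\<close>.\<close>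

lemma norm_scalar_compose:
  fixes T :: "'a ell2 \<Rightarrow>\<^sub>L 'a ell2"
  shows "norm (scalar c o\<^sub>L T) = cmod c * norm T"
proof (rule antisym)
  have le: "norm (scalar c o\<^sub>L T) \<le> cmod c * norm T" for c and T :: "'a ell2 \<Rightarrow>\<^sub>L 'a ell2"
    using norm_blinfun[of T] by (intro norm_blinfun_bound)
      (simp_all add: norm_scaleC mult.assoc mult_left_mono)
  then show "norm (scalar c o\<^sub>L T) \<le> cmod c * norm T" .
  show "cmod c * norm T \<le> norm (scalar c o\<^sub>L T)"
  proof (cases "c = 0")
    case False
    have "scalar (inverse c) o\<^sub>L (scalar c o\<^sub>L T) = T"
      using False by (intro blinfun_eqI ell2_eqI) simp
    with le[of "inverse c" "scalar c o\<^sub>L T"] have "norm T \<le> inverse (cmod c) * norm (scalar c o\<^sub>L T)"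
      by (simp add: norm_inverse)
    then show ?thesis using False by (simp add: field_simps)
  qed simp
qed

lift_definition delta :: "'a \<Rightarrow> 'a ell2" is "\<lambda>a x. if x = a then 1 else 0"
proof -
  fix a :: 'a
  have "(\<lambda>x. (norm (if x = a then 1 else 0 :: complex))\<^sup>2) summable_on {a}" by simp
  then show "(\<lambda>x. (norm (if x = a then 1 else 0 :: complex))\<^sup>2) summable_on UNIV"
    by (rule summable_on_cong_neutral[THEN iffD1, rotated -1]) auto
qed

lemma inner_delta: "inner f (delta a) = Re (coord f a)"
proof -
  have "inner f (delta a) = (\<Sum>\<^sub>\<infinity>x\<in>{a}. inner (coord f x) (coord (delta a) x))"
    unfolding inner_ell2_def by (rule infsum_cong_neutral) (auto simp: delta.rep_eq)
  then show ?thesis by (simp add: delta.rep_eq inner_complex_def)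
qed

section \<open>Commutants as C*-algebras\<close>

text \<open>Requiring an adjoint makes the star available on every element; it stays inside once
  \<open>R\<close> is closed under adjoints.\<close>

definition commutant :: "('i ell2 \<Rightarrow>\<^sub>L 'i ell2) set \<Rightarrow> ('i ell2 \<Rightarrow>\<^sub>L 'i ell2) set" where
  "commutant R = {T. (\<exists>S. adjoint_pair T S) \<and> (\<forall>U\<in>R. \<forall>f. T (U f) = U (T f))}"

definition blinfun_adjoint :: "('i ell2 \<Rightarrow>\<^sub>L 'i ell2) \<Rightarrow> ('i ell2 \<Rightarrow>\<^sub>L 'i ell2)" where
  "blinfun_adjoint T = (THE S. adjoint_pair T S)"

lemma adjoint_eqI: "adjoint_pair T S \<Longrightarrow> blinfun_adjoint T = S"
  unfolding blinfun_adjoint_def by (rule the_equality) (auto intro: adjoint_pair_unique)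

text \<open>The injection \<open>enc\<close> transports operators to the type that hosts the
  carrier. Scalars in \<open>R\<close> force the commutant to be complex linear, and adjoints in
  \<open>R\<close> make it closed under the star.\<close>

locale operator_algebra =
  fixes enc :: "('i ell2 \<Rightarrow>\<^sub>L 'i ell2) \<Rightarrow> 'x" and R :: "('i ell2 \<Rightarrow>\<^sub>L 'i ell2) set"
  assumes inj_enc: "inj enc"
    and scalar_in_R: "scalar c \<in> R"
    and R_scaleC: "U \<in> R \<Longrightarrow> U (scaleC c f) = scaleC c (U f)"
    and adjoint_in_R: "U \<in> R \<Longrightarrow> \<exists>V\<in>R. adjoint_pair U V"
begin

abbreviation dec :: "'x \<Rightarrow> ('i ell2 \<Rightarrow>\<^sub>L 'i ell2)" where "dec \<equiv> the_inv enc"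

lemma dec_enc [simp]: "dec (enc T) = T"
  by (rule the_inv_f_f[OF inj_enc])

lemma enc_eq_iff [simp]: "enc T = enc S \<longleftrightarrow> T = S"
  using inj_enc by (auto dest: injD)

definition A :: "'x cstar_structure" where
  "A = \<lparr>carrier = enc ` commutant R,
        mult = \<lambda>x y. enc (dec x o\<^sub>L dec y), one = enc id_blinfun,
        zero = enc 0, add = \<lambda>x y. enc (dec x + dec y),
        smult = \<lambda>c x. enc (scalar c o\<^sub>L dec x),
        star = \<lambda>x. enc (blinfun_adjoint (dec x)), nrm = \<lambda>x. norm (dec x)\<rparr>"

lemma A_simps [simp]:
  "carrier A = enc ` commutant R" "enc T \<otimes>\<^bsub>A\<^esub> enc S = enc (T o\<^sub>L S)" "\<one>\<^bsub>A\<^esub> = enc id_blinfun"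
  "\<zero>\<^bsub>A\<^esub> = enc 0" "enc T \<oplus>\<^bsub>A\<^esub> enc S = enc (T + S)" "c \<odot>\<^bsub>A\<^esub> enc T = enc (scalar c o\<^sub>L T)"
  "star A (enc T) = enc (blinfun_adjoint T)" "nrm A (enc T) = norm T"
  by (simp_all add: A_def)

lemma commutantI:
  "adjoint_pair T S \<Longrightarrow> (\<And>U f. U \<in> R \<Longrightarrow> T (U f) = U (T f)) \<Longrightarrow> T \<in> commutant R"
  by (auto simp: commutant_def)

lemma commute: "T \<in> commutant R \<Longrightarrow> U \<in> R \<Longrightarrow> T (U f) = U (T f)"
  by (simp add: commutant_def)

lemma commute_scaleC: "T \<in> commutant R \<Longrightarrow> T (scaleC c f) = scaleC c (T f)"
  using commute[OF _ scalar_in_R[of c]] by simp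

lemma adjoint_pair_adjoint: "T \<in> commutant R \<Longrightarrow> adjoint_pair T (blinfun_adjoint T)"
  by (auto simp: commutant_def adjoint_eqI)

text \<open>Testing against \<open>g\<close> moves both operators to the other side, where
  \<open>T\<close> commutes with the adjoint \<open>V\<close> of \<open>U\<close>.\<close>

lemma adjoint_commutant:
  assumes T: "T \<in> commutant R"
  shows "blinfun_adjoint T \<in> commutant R"
proof (rule commutantI)
  show "adjoint_pair (blinfun_adjoint T) T"
    by (rule adjoint_pair_sym[OF adjoint_pair_adjoint[OF T]])
  fix U f assume "U \<in> R"
  then obtain V where V: "V \<in> R" "adjoint_pair U V" using adjoint_in_R by blast
  have "inner g (blinfun_adjoint T (U f)) = inner g (U (blinfun_adjoint T f))" for g
  proof -
    have "inner g (blinfun_adjoint T (U f)) = inner (V (T g)) f"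
      using adjoint_pairD[OF adjoint_pair_adjoint[OF T]]
        adjoint_pairD[OF adjoint_pair_sym[OF V(2)]] by metis
    also have "\<dots> = inner (T (V g)) f" using commute[OF T V(1)] by simp
    also have "\<dots> = inner g (U (blinfun_adjoint T f))"
      using adjoint_pairD[OF adjoint_pair_adjoint[OF T]]
        adjoint_pairD[OF adjoint_pair_sym[OF V(2)]] by metis
    finally show ?thesis .
  qed
  then show "blinfun_adjoint T (U f) = U (blinfun_adjoint T f)" using vector_eq_ldot by blast
qed

lemma id_commutant: "id_blinfun \<in> commutant R"
  by (rule commutantI[OF adjoint_pair_id]) simp

lemma zero_commutant: "0 \<in> commutant R"
  by (rule commutantI[OF adjoint_pair_0]) (simp add: blinfun.zero_right)

lemma add_commutant: "T \<in> commutant R \<Longrightarrow> S \<in> commutant R \<Longrightarrow> T + S \<in> commutant R"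
  by (rule commutantI[OF adjoint_pair_add[OF adjoint_pair_adjoint adjoint_pair_adjoint]])
     (simp_all add: blinfun.add_left blinfun.add_right commute)

lemma compose_commutant: "T \<in> commutant R \<Longrightarrow> S \<in> commutant R \<Longrightarrow> T o\<^sub>L S \<in> commutant R"
  by (rule commutantI[OF adjoint_pair_compose[OF adjoint_pair_adjoint adjoint_pair_adjoint]])
     (simp_all add: commute)

lemma scalar_commutant: "T \<in> commutant R \<Longrightarrow> scalar c o\<^sub>L T \<in> commutant R"
  by (rule commutantI[OF adjoint_pair_compose[OF adjoint_pair_scalar adjoint_pair_adjoint]])
     (simp_all add: commute R_scaleC)

lemma adjoint_scalar:
  assumes T: "T \<in> commutant R"
  shows "blinfun_adjoint (scalar c o\<^sub>L T) = scalar (cnj c) o\<^sub>L blinfun_adjoint T"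
proof -
  have "blinfun_adjoint (scalar c o\<^sub>L T) = blinfun_adjoint T o\<^sub>L scalar (cnj c)"
    by (rule adjoint_eqI[OF adjoint_pair_compose[OF adjoint_pair_scalar adjoint_pair_adjoint[OF T]]])
  then show ?thesis
    using commute_scaleC[OF adjoint_commutant[OF T]] by (simp add: blinfun_eqI)
qed

text \<open>Taking adjoints preserves the norm of differences, so the adjoints converge too, and
  their limit is adjoint to the limit. The commutation relations pass to the limit
  pointwise.\<close>

lemma closed_commutant:
  assumes X: "\<And>n::nat. T n \<in> commutant R" and Cauchy: "Cauchy T"
  obtains L where "L \<in> commutant R" "T \<longlonglongrightarrow> L"
proof -
  have adj: "adjoint_pair (T n) (blinfun_adjoint (T n))" for n
    by (rule adjoint_pair_adjoint[OF X])
  have "norm (blinfun_adjoint (T m) - blinfun_adjoint (T n)) = norm (T m - T n)" for m n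
    using adjoint_pair_add[OF adj[of m] adjoint_pair_scaleR[OF adj[of n], of "-1"]]
    by (intro norm_adjoint) simp
  then have "Cauchy (\<lambda>n. blinfun_adjoint (T n))" using Cauchy by (simp add: Cauchy_iff)
  then obtain K where K: "(\<lambda>n. blinfun_adjoint (T n)) \<longlonglongrightarrow> K"
    by (blast dest: Cauchy_convergent convergentD)
  obtain L where L: "T \<longlonglongrightarrow> L"
    using Cauchy by (blast dest: Cauchy_convergent convergentD)
  have "L \<in> commutant R"
  proof (rule commutantI)
    have "inner (L f) g = inner f (K g)" for f g
    proof (rule LIMSEQ_unique)
      show "(\<lambda>n. inner (T n f) g) \<longlonglongrightarrow> inner (L f) g" by (intro tendsto_intros L)
      show "(\<lambda>n. inner (T n f) g) \<longlonglongrightarrow> inner f (K g)"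
        unfolding adjoint_pairD[OF adj] by (intro tendsto_intros K)
    qed
    then show "adjoint_pair L K" by (simp add: adjoint_pair_def)
    fix U f assume U: "U \<in> R"
    show "L (U f) = U (L f)"
    proof (rule LIMSEQ_unique)
      show "(\<lambda>n. T n (U f)) \<longlonglongrightarrow> L (U f)" by (intro tendsto_intros L)
      show "(\<lambda>n. T n (U f)) \<longlonglongrightarrow> U (L f)"
        unfolding commute[OF X U] by (intro tendsto_intros L)
    qed
  qed
  with L show ?thesis by (rule that[rotated])
qed

lemma abelian_group_A: "abelian_group A"
proof (rule abelian_groupI)
  show "\<exists>y\<in>carrier A. y \<oplus>\<^bsub>A\<^esub> x = \<zero>\<^bsub>A\<^esub>" if "x \<in> carrier A" for x
  proof -
    from that obtain T where T: "x = enc T" "T \<in> commutant R" by auto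
    have "(scalar (-1) o\<^sub>L T) + T = 0"
      by (intro blinfun_eqI ell2_eqI) (simp add: blinfun.add_left)
    then show ?thesis using T scalar_commutant by (intro bexI[of _ "enc (scalar (-1) o\<^sub>L T)"]) simp_all
  qed
qed (auto simp: zero_commutant add_commutant)

lemma ring_A: "ring A"
proof (rule ringI[OF abelian_group_A])
  show "monoid A"
    by (rule monoidI) (auto simp: compose_commutant id_commutant intro!: blinfun_eqI)
qed (auto intro!: blinfun_eqI simp: blinfun.add_left blinfun.add_right)

lemma minus_A:
  assumes "T \<in> commutant R" "S \<in> commutant R"
  shows "enc T \<ominus>\<^bsub>A\<^esub> enc S = enc (T - S)"
proof -
  interpret ring A by (rule ring_A)
  have neg: "scalar (-1) o\<^sub>L S = - S"
    by (intro blinfun_eqI ell2_eqI) (simp add: blinfun.minus_left)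
  then have "- S \<in> commutant R" using scalar_commutant[OF assms(2), of "-1"] by simp
  then have "\<ominus>\<^bsub>A\<^esub> enc S = enc (- S)" using assms by (intro minus_equality) simp_all
  then show ?thesis by (simp add: a_minus_def)
qed

lemma cring_complex: "cring complex_field_ring"
proof (rule cringI)
  show "abelian_group complex_field_ring"
    by (rule abelian_groupI) (auto simp: complex_field_ring_def intro: exI[of _ "- _"])
  show "comm_monoid complex_field_ring"
    by (rule comm_monoidI) (auto simp: complex_field_ring_def)
qed (auto simp: complex_field_ring_def algebra_simps)

lemma cstar_algebra_A: "cstar_algebra A"
proof (intro cstar_algebra.intro cstar_algebra_axioms.intro ring_A)
  show "Module.module complex_field_ring A"
    by (rule moduleI[OF cring_complex abelian_group_A])
       (auto simp: complex_field_ring_def scalar_commutant algebra_simps blinfun.add_left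
         intro!: blinfun_eqI ell2_eqI)
  show "\<exists>x\<in>carrier A. (\<lambda>n. nrm A (X n \<ominus>\<^bsub>A\<^esub> x)) \<longlonglongrightarrow> 0"
    if X: "\<And>n. X n \<in> carrier A"
      and Cauchy: "\<And>e. 0 < e \<Longrightarrow> \<exists>N. \<forall>m\<ge>N. \<forall>n\<ge>N. nrm A (X m \<ominus>\<^bsub>A\<^esub> X n) < e" for X :: "nat \<Rightarrow> 'x"
  proof -
    have "\<forall>n. \<exists>T. T \<in> commutant R \<and> X n = enc T" using X by fastforce
    then obtain T where T: "\<And>n. T n \<in> commutant R" "\<And>n. X n = enc (T n)" by metis
    have "Cauchy T" using Cauchy by (simp add: T minus_A Cauchy_iff)
    then obtain L where L: "L \<in> commutant R" "T \<longlonglongrightarrow> L" using closed_commutant T(1) by blast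
    then have "(\<lambda>n. norm (T n - L)) \<longlonglongrightarrow> 0" by (simp add: LIM_zero_iff tendsto_norm_zero_iff)
    with L(1) show ?thesis by (intro bexI[of _ "enc L"]) (simp_all add: T minus_A)
  qed
next
  fix x y assume "x \<in> carrier A" "y \<in> carrier A"
  then show "star A (x \<oplus>\<^bsub>A\<^esub> y) = star A x \<oplus>\<^bsub>A\<^esub> star A y" "star A (x \<otimes>\<^bsub>A\<^esub> y) = star A y \<otimes>\<^bsub>A\<^esub> star A x"
    by (auto intro!: adjoint_eqI adjoint_pair_add adjoint_pair_compose adjoint_pair_adjoint)
next
  fix x assume "x \<in> carrier A"
  then show "nrm A (star A x \<otimes>\<^bsub>A\<^esub> x) = (nrm A x)\<^sup>2"
    by (auto intro!: norm_adjoint_compose adjoint_pair_adjoint)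
next
  fix x assume "x \<in> carrier A"
  then show "star A (star A x) = x"
    by (auto intro!: adjoint_eqI adjoint_pair_sym adjoint_pair_adjoint)
qed (auto simp: commute_scaleC adjoint_commutant adjoint_scalar norm_triangle_ineq
      norm_scalar_compose norm_blinfun_compose intro!: blinfun_eqI)

section \<open>Vector states and their faithfulness\<close>

definition vector_state :: "'i \<Rightarrow> 'x \<Rightarrow> complex" where
  "vector_state a x = coord (dec x (delta a)) a"

lemma vector_state_enc [simp]: "vector_state a (enc T) = coord (T (delta a)) a"
  by (simp add: vector_state_def)

text \<open>The real inner product only shows the real part of the state. The imaginary part is the
  real part after multiplication by \<open>-\<i>\<close>, which pairs \<open>T\<close> of the vector
  with a multiple of itself by \<open>\<i>\<close>, and such a pairing is zero.\<close>

lemma vector_state_square: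
  assumes T: "T \<in> commutant R"
  shows "vector_state a (enc (blinfun_adjoint T o\<^sub>L T)) = of_real ((norm (T (delta a)))\<^sup>2)"
proof -
  let ?S = "blinfun_adjoint T o\<^sub>L T" and ?v = "delta a"
  have inner_S: "inner (?S f) g = inner (T f) (T g)" for f g
    using adjoint_pairD[OF adjoint_pair_sym[OF adjoint_pair_adjoint[OF T]], of "T f" g] by simp
  have inner_ii: "inner f (scaleC \<i> f) = 0" for f :: "'i ell2"
    unfolding inner_ell2_def by (intro infsum_0) (simp add: inner_complex_def)
  have "Re (coord (?S ?v) a) = (norm (T ?v))\<^sup>2"
    using inner_S[of ?v ?v] by (simp add: inner_delta power2_norm_eq_inner)
  moreover have "Im (coord (?S ?v) a) = inner (T ?v) (T (scaleC (-\<i>) ?v))"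
  proof -
    have "Im (coord (?S ?v) a) = inner (scaleC (- \<i>) (?S ?v)) ?v"
      unfolding inner_delta by simp
    also have "\<dots> = inner (?S (scaleC (- \<i>) ?v)) ?v"
      using commute_scaleC[OF compose_commutant[OF adjoint_commutant[OF T] T]] by simp
    also have "\<dots> = inner (T ?v) (T (scaleC (-\<i>) ?v))"
      unfolding inner_S by (rule inner_commute)
    finally show ?thesis .
  qed
  moreover have "T (scaleC (-\<i>) ?v) = - scaleC \<i> (T ?v)"
    unfolding commute_scaleC[OF T] by (rule ell2_eqI) simp
  ultimately show ?thesis by (simp add: complex_eq_iff inner_ii)
qed

text \<open>The state of a square is the squared norm of \<open>T (delta a)\<close>, so a separating
  vector gives a faithful state.\<close>

lemma cstar_probability_space_A:
  assumes separating: "\<And>T. T \<in> commutant R \<Longrightarrow> T (delta a) = 0 \<Longrightarrow> T = 0"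
  shows "cstar_probability_space A (vector_state a)"
proof (intro cstar_probability_space.intro cstar_probability_space_axioms.intro cstar_algebra_A)
  show "vector_state a \<one>\<^bsub>A\<^esub> = 1" by (simp add: delta.rep_eq)
next
  fix x assume "x \<in> carrier A"
  then obtain T where T: "x = enc T" "T \<in> commutant R" by auto
  show "vector_state a (star A x \<otimes>\<^bsub>A\<^esub> x) \<in> \<real>\<^sub>\<ge>\<^sub>0"
    using vector_state_square[OF T(2), of a] by (simp add: T(1) del: vector_state_enc)
  assume "vector_state a (star A x \<otimes>\<^bsub>A\<^esub> x) = 0"
  then have "T (delta a) = 0"
    using vector_state_square[OF T(2), of a] by (simp add: T(1) del: vector_state_enc)
  then show "x = \<zero>\<^bsub>A\<^esub>" using separating T by simp
qed (auto simp: blinfun.add_left)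

end

section \<open>Sums over noncrossing partitions\<close>

text \<open>Arbitrary sets of positions, not just initial segments, because the recursion below
  passes to subsets.\<close>

definition nc_partitions :: "nat set \<Rightarrow> nat set set set" where
  "nc_partitions A = {P. partition_on A P \<and> noncrossing P}"

lemma nc_partitions_lessThan: "nc_partitions {..<n} = NC n"
  by (simp add: nc_partitions_def NC_def)

lemma finite_nc_partitions: "finite A \<Longrightarrow> finite (nc_partitions A)"
  by (rule finite_subset[of _ "Pow (Pow A)"]) (auto simp: nc_partitions_def partition_on_def)

lemma finite_nc_partition: "finite A \<Longrightarrow> P \<in> nc_partitions A \<Longrightarrow> finite P"
  by (auto simp: nc_partitions_def intro: finite_elements)

lemma nc_partition_blockD:
  "P \<in> nc_partitions A \<Longrightarrow> V \<in> P \<Longrightarrow> V \<noteq> {} \<and> V \<subseteq> A"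
  by (auto simp: nc_partitions_def partition_on_def)

lemma nc_partition_block_eq:
  "P \<in> nc_partitions A \<Longrightarrow> V \<in> P \<Longrightarrow> W \<in> P \<Longrightarrow> x \<in> V \<Longrightarrow> x \<in> W \<Longrightarrow> V = W"
  by (auto simp: nc_partitions_def partition_on_def disjoint_def)

lemma nc_partition_block_ex: "P \<in> nc_partitions A \<Longrightarrow> x \<in> A \<Longrightarrow> \<exists>V\<in>P. x \<in> V"
  by (auto simp: nc_partitions_def partition_on_def)

lemma nc_partition_not_crossing:
  "P \<in> nc_partitions A \<Longrightarrow> V \<in> P \<Longrightarrow> W \<in> P \<Longrightarrow> i < j \<Longrightarrow> j < k \<Longrightarrow> k < l \<Longrightarrow>
    i \<in> V \<Longrightarrow> k \<in> V \<Longrightarrow> j \<in> W \<Longrightarrow> l \<in> W \<Longrightarrow> V = W"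
  unfolding nc_partitions_def noncrossing_def by blast

lemma noncrossing_subset: "noncrossing P \<Longrightarrow> Q \<subseteq> P \<Longrightarrow> noncrossing Q"
  unfolding noncrossing_def by (meson subsetD)

lemma nc_partitions_subset:
  assumes "P \<in> nc_partitions A" "B \<subseteq> A" "\<And>V. V \<in> P \<Longrightarrow> V \<subseteq> B \<or> V \<inter> B = {}"
  shows "{V \<in> P. V \<subseteq> B} \<in> nc_partitions B"
proof -
  have "\<Union> {V \<in> P. V \<subseteq> B} = B"
  proof (intro equalityI subsetI)
    fix x assume "x \<in> B"
    with nc_partition_block_ex[OF assms(1), of x] assms(2) obtain V where "V \<in> P" "x \<in> V" by blast
    with assms(3)[of V] \<open>x \<in> B\<close> show "x \<in> \<Union> {V \<in> P. V \<subseteq> B}" by blast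
  qed auto
  moreover have "disjoint {V \<in> P. V \<subseteq> B}" "{} \<notin> {V \<in> P. V \<subseteq> B}"
    using assms(1) by (auto simp: nc_partitions_def partition_on_def disjoint_def)
  moreover have "noncrossing {V \<in> P. V \<subseteq> B}"
    using assms(1) by (auto simp: nc_partitions_def elim: noncrossing_subset)
  ultimately show ?thesis by (simp add: nc_partitions_def partition_on_def)
qed

text \<open>The set \<open>B\<close> lies in one gap of \<open>C\<close>. A crossing between a block
  of \<open>Q\<close> and a block of \<open>R\<close> would put an element of \<open>C\<close>
  between two elements of \<open>B\<close>.\<close>

lemma nc_partitions_Un:
  assumes Q: "Q \<in> nc_partitions B" and R: "R \<in> nc_partitions C" and disj: "B \<inter> C = {}"
    and interval: "\<And>i j k. i < j \<Longrightarrow> j < k \<Longrightarrow> i \<in> B \<Longrightarrow> k \<in> B \<Longrightarrow> j \<notin> C"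
  shows "Q \<union> R \<in> nc_partitions (B \<union> C)"
proof -
  have "partition_on (B \<union> C) (Q \<union> R)"
    using Q R disj by (auto simp: nc_partitions_def partition_on_def intro!: disjoint_union)
  moreover have "noncrossing (Q \<union> R)"
    unfolding noncrossing_def
  proof (intro notI, elim bexE conjE exE)
    fix V W i j k l
    assume VW: "V \<in> Q \<union> R" "W \<in> Q \<union> R" "V \<noteq> W"
      and ijkl: "i < j" "j < k" "k < l" "i \<in> V" "k \<in> V" "j \<in> W" "l \<in> W"
    note sub = nc_partition_blockD[OF Q] nc_partition_blockD[OF R]
    from VW consider "V \<in> Q" "W \<in> Q" | "V \<in> R" "W \<in> R" | "V \<in> Q" "W \<in> R" | "V \<in> R" "W \<in> Q"
      by blast
    then show False
    proof cases
      case 1 then show ?thesis using nc_partition_not_crossing[OF Q 1 ijkl] VW by simp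
    next
      case 2 then show ?thesis using nc_partition_not_crossing[OF R 2 ijkl] VW by simp
    next
      case 3 then show ?thesis using interval[of i j k] sub ijkl by blast
    next
      case 4 then show ?thesis using interval[of j k l] sub ijkl by blast
    qed
  qed
  ultimately show ?thesis by (simp add: nc_partitions_def)
qed

text \<open>A partition without blocks straddling \<open>B\<close> and \<open>C\<close> is the same
  as a pair of partitions, and the weight factors. The predicate \<open>\<Phi>\<close> carries a
  side condition on the part in \<open>C\<close>, here about the block being followed.\<close>

lemma sum_nc_partitions_Un:
  fixes g :: "nat set \<Rightarrow> complex"
  assumes fin: "finite B" "finite C" and disj: "B \<inter> C = {}"
    and interval: "\<And>i j k. i < j \<Longrightarrow> j < k \<Longrightarrow> i \<in> B \<Longrightarrow> k \<in> B \<Longrightarrow> j \<notin> C"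
  shows "(\<Sum>P\<in>{P \<in> nc_partitions (B \<union> C). (\<forall>V\<in>P. V \<subseteq> B \<or> V \<subseteq> C) \<and> \<Phi> {V \<in> P. V \<subseteq> C}}. prod g P) =
    (\<Sum>Q\<in>nc_partitions B. prod g Q) * (\<Sum>R\<in>{R \<in> nc_partitions C. \<Phi> R}. prod g R)"
proof -
  have Un: "{V \<in> Q \<union> R. V \<subseteq> B} = Q" "{V \<in> Q \<union> R. V \<subseteq> C} = R"
    if "Q \<in> nc_partitions B" "R \<in> nc_partitions C" for Q R
    using nc_partition_blockD[OF that(1)] nc_partition_blockD[OF that(2)] disj by blast+
  have "(\<Sum>P\<in>{P \<in> nc_partitions (B \<union> C). (\<forall>V\<in>P. V \<subseteq> B \<or> V \<subseteq> C) \<and> \<Phi> {V \<in> P. V \<subseteq> C}}. prod g P) =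
      (\<Sum>(Q, R)\<in>nc_partitions B \<times> {R \<in> nc_partitions C. \<Phi> R}. prod g Q * prod g R)"
  proof (rule sum.reindex_bij_witness[of _ "\<lambda>(Q, R). Q \<union> R"
        "\<lambda>P. ({V \<in> P. V \<subseteq> B}, {V \<in> P. V \<subseteq> C})"])
    fix P assume P: "P \<in> {P \<in> nc_partitions (B \<union> C). (\<forall>V\<in>P. V \<subseteq> B \<or> V \<subseteq> C) \<and> \<Phi> {V \<in> P. V \<subseteq> C}}"
    then show eq: "(case ({V \<in> P. V \<subseteq> B}, {V \<in> P. V \<subseteq> C}) of (Q, R) \<Rightarrow> Q \<union> R) = P" by auto
    show "({V \<in> P. V \<subseteq> B}, {V \<in> P. V \<subseteq> C}) \<in> nc_partitions B \<times> {R \<in> nc_partitions C. \<Phi> R}"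
      using P disj nc_partitions_subset[of P "B \<union> C" B] nc_partitions_subset[of P "B \<union> C" C] by blast
    have "{V \<in> P. V \<subseteq> B} \<inter> {V \<in> P. V \<subseteq> C} = {}"
    proof -
      have False if "V \<in> P" "V \<subseteq> B" "V \<subseteq> C" for V
        using nc_partition_blockD[of P "B \<union> C" V] that P disj by auto
      then show ?thesis by blast
    qed
    moreover have "finite P" using P fin by (auto intro: finite_nc_partition[of "B \<union> C"])
    ultimately have "prod g ({V \<in> P. V \<subseteq> B} \<union> {V \<in> P. V \<subseteq> C}) =
        prod g {V \<in> P. V \<subseteq> B} * prod g {V \<in> P. V \<subseteq> C}"
      by (intro prod.union_disjoint) auto
    with eq show "(case ({V \<in> P. V \<subseteq> B}, {V \<in> P. V \<subseteq> C}) of (Q, R) \<Rightarrow> prod g Q * prod g R) = prod g P"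
      by simp
  next
    fix QR assume QR: "QR \<in> nc_partitions B \<times> {R \<in> nc_partitions C. \<Phi> R}"
    then obtain Q R where QR': "QR = (Q, R)" "Q \<in> nc_partitions B" "R \<in> nc_partitions C" "\<Phi> R" by auto
    show "({V \<in> (case QR of (Q, R) \<Rightarrow> Q \<union> R). V \<subseteq> B}, {V \<in> (case QR of (Q, R) \<Rightarrow> Q \<union> R). V \<subseteq> C}) = QR"
      using Un[OF QR'(2,3)] by (simp add: QR'(1))
    show "(case QR of (Q, R) \<Rightarrow> Q \<union> R) \<in>
        {P \<in> nc_partitions (B \<union> C). (\<forall>V\<in>P. V \<subseteq> B \<or> V \<subseteq> C) \<and> \<Phi> {V \<in> P. V \<subseteq> C}}"
      using nc_partitions_Un[OF QR'(2,3) disj interval] Un[OF QR'(2,3)] QR'(4)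
        nc_partition_blockD[OF QR'(2)] nc_partition_blockD[OF QR'(3)]
      by (auto simp: QR'(1))
  qed
  then show ?thesis by (simp add: sum_product sum.cartesian_product)
qed

section \<open>Recursion along the block of the first element\<close>

definition word_at :: "(nat \<Rightarrow> 'a) \<Rightarrow> nat set \<Rightarrow> 'a list" where
  "word_at \<omega> A = map \<omega> (sorted_list_of_set A)"

definition nc_sum :: "(nat set \<Rightarrow> complex) \<Rightarrow> nat set \<Rightarrow> complex" where
  "nc_sum g A = (\<Sum>P\<in>nc_partitions A. prod g P)"

text \<open>\<open>U\<close> is the part of one block read so far; \<open>A\<close> holds the
  positions still to be distributed.\<close>

definition nc_sum_block :: "(nat set \<Rightarrow> complex) \<Rightarrow> nat set \<Rightarrow> nat set \<Rightarrow> complex" where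
  "nc_sum_block g U A = (\<Sum>P\<in>{P \<in> nc_partitions (U \<union> A). \<exists>V\<in>P. U \<subseteq> V}. prod g P)"

lemma nc_sum_empty: "nc_sum g {} = 1"
proof -
  have "nc_partitions {} = {{}}"
    by (auto simp: nc_partitions_def partition_on_def noncrossing_def)
  then show ?thesis by (simp add: nc_sum_def)
qed

lemma nc_sum_Min:
  assumes "finite A" "A \<noteq> {}"
  shows "nc_sum g A = nc_sum_block g {Min A} (A - {Min A})"
proof -
  have "insert (Min A) (A - {Min A}) = A" using Min_in[OF assms] by blast
  moreover have "{P \<in> nc_partitions A. \<exists>V\<in>P. {Min A} \<subseteq> V} = nc_partitions A"
    using nc_partition_block_ex Min_in[OF assms] by fastforce
  ultimately show ?thesis by (simp add: nc_sum_def nc_sum_block_def)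
qed

text \<open>The next element of the block containing \<open>U\<close>, if any, is \<open>a\<close>; the elements of \<open>A\<close>
  below \<open>a\<close> are then separated from the rest.\<close>

lemma nc_sum_block_rec:
  assumes fin: "finite U" "finite A" and U: "U \<noteq> {}" and less: "\<And>u a. u \<in> U \<Longrightarrow> a \<in> A \<Longrightarrow> u < a"
  shows "nc_sum_block g U A = g U * nc_sum g A +
    (\<Sum>a\<in>A. nc_sum g {x \<in> A. x < a} * nc_sum_block g (insert a U) {x \<in> A. a < x})"
proof -
  \<comment> \<open>In \<open>X\<close> the block is complete; in \<open>Y a\<close> it continues,
    and \<open>a\<close> is its next element.\<close>
  define X where "X = {P \<in> nc_partitions (U \<union> A). U \<in> P}"
  define Y where "Y a = {P \<in> nc_partitions (U \<union> A). \<exists>V\<in>P. insert a U \<subseteq> V \<and> V \<inter> {x \<in> A. x < a} = {}}" for a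
  obtain u where u: "u \<in> U" using U by blast
  have UA: "U \<inter> A = {}" using less by blast
  have eq: "{P \<in> nc_partitions (U \<union> A). \<exists>V\<in>P. U \<subseteq> V} = X \<union> (\<Union>a\<in>A. Y a)"
  proof (intro equalityI subsetI)
    fix P assume "P \<in> {P \<in> nc_partitions (U \<union> A). \<exists>V\<in>P. U \<subseteq> V}"
    then obtain V where P: "P \<in> nc_partitions (U \<union> A)" and V: "V \<in> P" "U \<subseteq> V" by blast
    show "P \<in> X \<union> (\<Union>a\<in>A. Y a)"
    proof (cases "V = U")
      case True then show ?thesis using P V by (simp add: X_def)
    next
      case False
      then have ne: "V \<inter> A \<noteq> {}" using nc_partition_blockD[OF P V(1)] V(2) by blast
      define a where "a = Min (V \<inter> A)"
      have a: "a \<in> V" "a \<in> A" using Min_in[OF _ ne] fin by (auto simp: a_def)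
      have "V \<inter> {x \<in> A. x < a} = {}" 
      proof -
        have False if "x \<in> V" "x \<in> A" "x < a" for x
        proof -
          have "Min (V \<inter> A) \<le> x" by (rule Min_le) (use fin that in auto)
          then show ?thesis using that by (simp add: a_def)
        qed
        then show ?thesis by blast
      qed
      then have "P \<in> Y a" using P V a by (auto simp: Y_def)
      then show ?thesis using a by blast
    qed
  qed (auto simp: X_def Y_def)
  have X_Y: "X \<inter> (\<Union>a\<in>A. Y a) = {}"
  proof -
    have False if P: "P \<in> X" "P \<in> Y a" and a: "a \<in> A" for P a
    proof -
      from P obtain V where V: "P \<in> nc_partitions (U \<union> A)" "U \<in> P" "V \<in> P" "insert a U \<subseteq> V"
        by (auto simp: X_def Y_def)
      then have "U = V" using u by (intro nc_partition_block_eq[OF V(1-3), of u]) auto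
      then show False using V(4) UA a by blast
    qed
    then show ?thesis by blast
  qed
  have Y_Y: "Y a \<inter> Y b = {}" if "a \<in> A" "b \<in> A" "a \<noteq> b" for a b
  proof -
    have *: False if P: "P \<in> Y a" "P \<in> Y b" and ab: "a \<in> A" "b \<in> A" "a < b" for P a b
    proof -
      from P obtain V W where V: "P \<in> nc_partitions (U \<union> A)" "V \<in> P" "W \<in> P"
          "insert a U \<subseteq> V" "insert b U \<subseteq> W" "W \<inter> {x \<in> A. x < b} = {}"
        by (auto simp: Y_def)
      then have "V = W" using u by (intro nc_partition_block_eq[OF V(1-3), of u]) auto
      then show False using V ab by blast
    qed
    show ?thesis using *[of _ a b] *[of _ b a] that by (auto simp: neq_iff)
  qed
  have sum_X: "sum (prod g) X = g U * nc_sum g A"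
  proof -
    \<comment> \<open>The completed block is split off: \<open>U\<close> carries the single
      partition \<open>{U}\<close>, and \<open>A\<close> is partitioned freely.\<close>
    have "X = {P \<in> nc_partitions (A \<union> U). (\<forall>V\<in>P. V \<subseteq> A \<or> V \<subseteq> U) \<and> {V \<in> P. V \<subseteq> U} = {U}}"
    proof (intro equalityI subsetI)
      fix P assume "P \<in> X"
      then have P: "P \<in> nc_partitions (U \<union> A)" "U \<in> P" by (auto simp: X_def)
      have cases: "V \<subseteq> A \<or> V = U" if "V \<in> P" for V
        using nc_partition_block_eq[OF P(1) that P(2)] nc_partition_blockD[OF P(1) that] by blast
      then have "V = U" if "V \<in> P" "V \<subseteq> U" for V
        using nc_partition_blockD[OF P(1) that(1)] that UA by blast
      with P(2) have "{V \<in> P. V \<subseteq> U} = {U}" by blast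
      with P cases show "P \<in> {P \<in> nc_partitions (A \<union> U). (\<forall>V\<in>P. V \<subseteq> A \<or> V \<subseteq> U) \<and> {V \<in> P. V \<subseteq> U} = {U}}"
        by (auto simp: Un_commute)
    next
      fix P assume "P \<in> {P \<in> nc_partitions (A \<union> U). (\<forall>V\<in>P. V \<subseteq> A \<or> V \<subseteq> U) \<and> {V \<in> P. V \<subseteq> U} = {U}}"
      then have "P \<in> nc_partitions (U \<union> A)" "U \<in> {V \<in> P. V \<subseteq> U}" by (auto simp: Un_commute)
      then show "P \<in> X" by (simp add: X_def)
    qed
    then have "sum (prod g) X = nc_sum g A * (\<Sum>R\<in>{R \<in> nc_partitions U. R = {U}}. prod g R)"
      unfolding nc_sum_def using fin less UA
      by (subst sum_nc_partitions_Un[symmetric]) (auto dest: less_trans order.asym)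
    moreover have "{U} \<in> nc_partitions U"
      using U by (auto simp: nc_partitions_def partition_on_def disjoint_def noncrossing_def)
    then have "{R \<in> nc_partitions U. R = {U}} = {{U}}" by blast
    ultimately show ?thesis by simp
  qed
  have sum_Y: "sum (prod g) (Y a) = nc_sum g {x \<in> A. x < a} * nc_sum_block g (insert a U) {x \<in> A. a < x}"
    if a: "a \<in> A" for a
  proof -
    let ?B = "{x \<in> A. x < a}" and ?C = "insert a U \<union> {x \<in> A. a < x}"
    have BC: "?B \<union> ?C = U \<union> A" using a by (auto simp: neq_iff)
    have disj: "?B \<inter> ?C = {}" using UA by auto
    have Y_eq: "Y a = {P \<in> nc_partitions (?B \<union> ?C). (\<forall>V\<in>P. V \<subseteq> ?B \<or> V \<subseteq> ?C) \<and>
        (\<exists>V\<in>{V \<in> P. V \<subseteq> ?C}. insert a U \<subseteq> V)}" (is "_ = ?Z")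
    proof (intro equalityI subsetI)
      fix P assume "P \<in> Y a"
      then obtain V where P: "P \<in> nc_partitions (U \<union> A)"
        and V: "V \<in> P" "insert a U \<subseteq> V" "V \<inter> ?B = {}" by (auto simp: Y_def)
      have VC: "V \<subseteq> ?C" using nc_partition_blockD[OF P V(1)] V(3) BC by blast
      have "W \<subseteq> ?B \<or> W \<subseteq> ?C" if W: "W \<in> P" for W
      proof (rule ccontr)
        assume "\<not> (W \<subseteq> ?B \<or> W \<subseteq> ?C)"
        then obtain b c where b: "b \<in> W" "b \<in> ?B" and c: "c \<in> W" "c \<in> ?C"
          using nc_partition_blockD[OF P W] BC by blast
        have "W \<noteq> V" using b V(3) by blast
        then have "c \<notin> V" using nc_partition_block_eq[OF P W V(1) c(1)] by blast
        then have "a < c" using c V(2) by blast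
        \<comment> \<open>Here \<open>u < b < a < c\<close> with \<open>u\<close>, \<open>a\<close>
          in \<open>V\<close> and \<open>b\<close>, \<open>c\<close> in \<open>W\<close>, which is a
          crossing.\<close>
        then show False
          using nc_partition_not_crossing[OF P V(1) W, of u b a c] b c u V(2) less[OF u] \<open>W \<noteq> V\<close> by auto
      qed
      then show "P \<in> ?Z" using P V VC unfolding BC by blast
    next
      fix P assume "P \<in> ?Z"
      then obtain V where P: "P \<in> nc_partitions (U \<union> A)"
        and V: "V \<in> P" "V \<subseteq> ?C" "insert a U \<subseteq> V" unfolding BC by blast
      have "V \<inter> ?B = {}" using V(2) disj by blast
      with P V show "P \<in> Y a" unfolding Y_def by blast
    qed
    have "sum (prod g) (Y a) = nc_sum g ?B * (\<Sum>R\<in>{R \<in> nc_partitions ?C. \<exists>V\<in>R. insert a U \<subseteq> V}. prod g R)"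
      unfolding Y_eq nc_sum_def
    proof (rule sum_nc_partitions_Un[where \<Phi> = "\<lambda>R. \<exists>V\<in>R. insert a U \<subseteq> V"])
      show "j \<notin> ?C" if "i < j" "j < k" "i \<in> ?B" "k \<in> ?B" for i j k
        using that less[of j i] by auto
    qed (use fin disj in simp_all)
    then show ?thesis by (simp add: nc_sum_block_def)
  qed
  have fin_nc: "finite (nc_partitions (U \<union> A))" using fin by (intro finite_nc_partitions) simp
  then have fin': "finite X" "\<And>a. finite (Y a)" by (auto simp: X_def Y_def)
  have "nc_sum_block g U A = sum (prod g) X + (\<Sum>a\<in>A. sum (prod g) (Y a))"
    unfolding nc_sum_block_def eq using fin fin' X_Y Y_Y
    by (simp add: sum.union_disjoint sum.UNION_disjoint)
  then show ?thesis using sum_X sum_Y by simp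
qed

lemma word_at_insert:
  assumes "finite U" "\<And>u. u \<in> U \<Longrightarrow> u < a"
  shows "word_at \<omega> (insert a U) = word_at \<omega> U @ [\<omega> a]"
proof -
  have "sorted_list_of_set (set (sorted_list_of_set U @ [a])) = sorted_list_of_set U @ [a]"
    using assms by (intro sorted_list_of_set.idem_if_sorted_distinct)
      (auto simp: sorted_append less_imp_le)
  then show ?thesis using assms by (simp add: word_at_def)
qed

lemma
  assumes "finite A" "i < card A"
  defines "a \<equiv> sorted_list_of_set A ! i"
  shows word_at_less: "word_at \<omega> {x \<in> A. x < a} = take i (word_at \<omega> A)"
    and word_at_greater: "word_at \<omega> {x \<in> A. a < x} = drop (Suc i) (word_at \<omega> A)"
    and word_at_nth: "word_at \<omega> A ! i = \<omega> a"
proof -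
  let ?l = "sorted_list_of_set A"
  have len: "length ?l = card A" by simp
  have less: "?l ! j < ?l ! k \<longleftrightarrow> j < k" if "j < card A" "k < card A" for j k
    using strict_sorted_list_of_set[of A] that len
    by (metis linorder_neqE_nat order.asym sorted_wrt_nth_less order_less_irrefl)
  have nth_A: "?l ! j \<in> A" if "j < card A" for j
    using that assms(1) by (metis len nth_mem set_sorted_list_of_set)
  have ex_nth: "\<exists>j<card A. x = ?l ! j" if "x \<in> A" for x
    using that assms(1) by (metis in_set_conv_nth len set_sorted_list_of_set)
  have "set (take i ?l) = {x \<in> A. x < a}"
  proof (intro equalityI subsetI)
    fix x assume "x \<in> set (take i ?l)"
    then obtain j where "j < i" "x = ?l ! j" by (auto simp: in_set_conv_nth)
    then show "x \<in> {x \<in> A. x < a}" using less[of j i] nth_A[of j] assms(2) by (simp add: a_def)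
  next
    fix x assume "x \<in> {x \<in> A. x < a}"
    then obtain j where j: "j < card A" "x = ?l ! j" "x < a" using ex_nth by blast
    then have "j < i" using less[of j i] assms(2) by (simp add: a_def)
    then show "x \<in> set (take i ?l)" using j assms(2)
      by (auto simp: in_set_conv_nth intro!: exI[of _ j])
  qed
  then have "sorted_list_of_set {x \<in> A. x < a} = take i ?l"
    by (metis distinct_sorted_list_of_set distinct_take sorted_list_of_set.idem_if_sorted_distinct
        sorted_sorted_list_of_set sorted_wrt_take)
  then show "word_at \<omega> {x \<in> A. x < a} = take i (word_at \<omega> A)" by (simp add: word_at_def take_map)
  have "set (drop (Suc i) ?l) = {x \<in> A. a < x}"
  proof (intro equalityI subsetI)
    fix x assume "x \<in> set (drop (Suc i) ?l)"
    then obtain j where "j < card A - Suc i" "x = ?l ! (Suc i + j)"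
      by (auto simp: in_set_conv_nth)
    then show "x \<in> {x \<in> A. a < x}" using less[of i "Suc i + j"] nth_A[of "Suc i + j"] assms(2) by (simp add: a_def)
  next
    fix x assume "x \<in> {x \<in> A. a < x}"
    then obtain j where j: "j < card A" "x = ?l ! j" "a < x" using ex_nth by blast
    then have "i < j" using less[of i j] assms(2) by (simp add: a_def)
    then show "x \<in> set (drop (Suc i) ?l)" using j
      by (auto simp: in_set_conv_nth intro!: exI[of _ "j - Suc i"])
  qed
  then have "sorted_list_of_set {x \<in> A. a < x} = drop (Suc i) ?l"
    by (metis distinct_sorted_list_of_set distinct_drop sorted_list_of_set.idem_if_sorted_distinct
        sorted_sorted_list_of_set sorted_wrt_drop)
  then show "word_at \<omega> {x \<in> A. a < x} = drop (Suc i) (word_at \<omega> A)" by (simp add: word_at_def drop_map)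
  show "word_at \<omega> A ! i = \<omega> a" using assms(2) by (simp add: word_at_def a_def)
qed

lemma length_word_at: "length (word_at \<omega> A) = card A"
  by (simp add: word_at_def)

text \<open>The hypotheses on \<open>m\<close> and \<open>f\<close> are the recursions of
  \<open>nc_sum\<close> and \<open>nc_sum_block\<close> read off on words, so both pairs agree by
  induction on the number of positions.\<close>

lemma nc_sum_eqI:
  fixes \<kappa> m :: "'a list \<Rightarrow> complex" and f :: "'a list \<Rightarrow> 'a list \<Rightarrow> complex"
  assumes m_Nil: "m [] = 1" and m_Cons: "\<And>x w. m (x # w) = f [x] w"
    and f: "\<And>u w. u \<noteq> [] \<Longrightarrow> f u w = \<kappa> u * m w +
      (\<Sum>i<length w. m (take i w) * f (u @ [w ! i]) (drop (Suc i) w))"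
    and "finite A"
  shows "nc_sum (\<lambda>V. \<kappa> (word_at \<omega> V)) A = m (word_at \<omega> A)"
proof -
  let ?g = "\<lambda>V. \<kappa> (word_at \<omega> V)"
  have "nc_sum ?g A = m (word_at \<omega> A) \<and>
     (\<forall>U. finite U \<longrightarrow> U \<noteq> {} \<longrightarrow> (\<forall>u\<in>U. \<forall>a\<in>A. u < a) \<longrightarrow>
        nc_sum_block ?g U A = f (word_at \<omega> U) (word_at \<omega> A))" if "finite A" for A
    using that
  proof (induction "card A" arbitrary: A rule: less_induct)
    case less
    note fin = \<open>finite A\<close>
    have IH1: "nc_sum ?g B = m (word_at \<omega> B)" if "B \<subset> A" for B
      using less.hyps[of B] psubset_card_mono[OF fin that] finite_subset[of B A] fin that by auto
    have IH2: "nc_sum_block ?g U B = f (word_at \<omega> U) (word_at \<omega> B)"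
      if "B \<subset> A" "finite U" "U \<noteq> {}" "\<forall>u\<in>U. \<forall>a\<in>B. u < a" for B U
      using less.hyps[of B] psubset_card_mono[OF fin that(1)] finite_subset[of B A] fin that by auto
    \<comment> \<open>This comes first: the recursion for a block sum over \<open>A\<close> contains
      the full sum over the same \<open>A\<close>. The full sum itself removes the least position
      and so only uses a smaller set.\<close>
    have S: "nc_sum ?g A = m (word_at \<omega> A)"
    proof (cases "A = {}")
      case False
      let ?a = "Min A"
      have a: "?a \<in> A" by (rule Min_in[OF fin False])
      have "nc_sum ?g A = f (word_at \<omega> {?a}) (word_at \<omega> (A - {?a}))"
        unfolding nc_sum_Min[OF fin False] using a Min_le[OF fin]
        by (intro IH2) (auto simp: order.strict_iff_order)
      also have "\<dots> = m (\<omega> ?a # word_at \<omega> (A - {?a}))" by (simp add: m_Cons word_at_def)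
      also have "\<omega> ?a # word_at \<omega> (A - {?a}) = word_at \<omega> A"
        using sorted_list_of_set_nonempty[OF fin False] by (simp add: word_at_def)
      finally show ?thesis .
    qed (simp add: nc_sum_empty m_Nil word_at_def)
    moreover have "nc_sum_block ?g U A = f (word_at \<omega> U) (word_at \<omega> A)"
      if U: "finite U" "U \<noteq> {}" "\<forall>u\<in>U. \<forall>a\<in>A. u < a" for U
    proof -
      let ?h = "\<lambda>a. nc_sum ?g {x \<in> A. x < a} * nc_sum_block ?g (insert a U) {x \<in> A. a < x}"
      let ?w = "word_at \<omega> A"
      have "bij_betw ((!) (sorted_list_of_set A)) {..<card A} A"
        using fin by (intro bij_betw_nth) auto
      then have "(\<Sum>a\<in>A. ?h a) = (\<Sum>i<card A. ?h (sorted_list_of_set A ! i))"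
        by (rule sum.reindex_bij_betw[symmetric])
      also have "\<dots> = (\<Sum>i<length ?w. m (take i ?w) * f (word_at \<omega> U @ [?w ! i]) (drop (Suc i) ?w))"
      proof (rule sum.cong)
        fix i assume "i \<in> {..<length ?w}"
        then have i: "i < card A" by (simp add: length_word_at)
        let ?a = "sorted_list_of_set A ! i"
        have a: "?a \<in> A" using i fin by (metis length_sorted_list_of_set nth_mem set_sorted_list_of_set)
        have "nc_sum ?g {x \<in> A. x < ?a} = m (take i ?w)"
          using a by (subst IH1) (auto simp: word_at_less[OF fin i])
        moreover have "nc_sum_block ?g (insert ?a U) {x \<in> A. ?a < x} =
            f (word_at \<omega> U @ [?w ! i]) (drop (Suc i) ?w)"
          using a U by (subst IH2) (auto simp: word_at_greater[OF fin i] word_at_nth[OF fin i]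
              intro!: arg_cong2[where f = f] word_at_insert)
        ultimately show "?h ?a = m (take i ?w) * f (word_at \<omega> U @ [?w ! i]) (drop (Suc i) ?w)" by simp
      qed (simp add: length_word_at)
      finally have "(\<Sum>a\<in>A. ?h a) =
          (\<Sum>i<length ?w. m (take i ?w) * f (word_at \<omega> U @ [?w ! i]) (drop (Suc i) ?w))" .
      moreover have "word_at \<omega> U \<noteq> []" using U by (simp add: word_at_def)
      ultimately show ?thesis
        using nc_sum_block_rec[OF U(1) fin U(2), of ?g] U(3) S f[of "word_at \<omega> U" ?w] by simp
    qed
    ultimately show ?case by blast
  qed
  then show ?thesis using \<open>finite A\<close> by blast
qed

section \<open>From the recursion to free cumulants\<close>

lemma nths_eq_word_at:
  assumes "V \<subseteq> {..<length w}"
  shows "nths w V = word_at ((!) w) V"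
proof -
  have "nths w V = map ((!) w) (filter (\<lambda>i. i \<in> V) [0..<length w])"
    by (induction w rule: rev_induct) (auto simp: nths_append nth_append intro!: map_cong)
  moreover have "set (filter (\<lambda>i. i \<in> V) [0..<length w]) = V" using assms by auto
  then have "sorted_list_of_set V = filter (\<lambda>i. i \<in> V) [0..<length w]"
    by (metis distinct_filter distinct_upt sorted_list_of_set.idem_if_sorted_distinct
        sorted_upt sorted_wrt_filter)
  ultimately show ?thesis by (simp add: word_at_def)
qed

text \<open>Both \<kappa> and the free cumulants solve the moment-cumulant formula. All blocks
  outside the one-block partition are shorter, so induction on length cancels everything except the
  top term.\<close>

lemma free_cumulant_star_word_eqI:
  fixes \<kappa> m :: "bool list \<Rightarrow> complex" and f :: "bool list \<Rightarrow> bool list \<Rightarrow> complex"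
  assumes moment: "\<And>w. \<phi> (list_product A (star_word A b w)) = m w"
    and m_Nil: "m [] = 1" and m_Cons: "\<And>x w. m (x # w) = f [x] w"
    and f: "\<And>u w. u \<noteq> [] \<Longrightarrow> f u w = \<kappa> u * m w +
      (\<Sum>i<length w. m (take i w) * f (u @ [w ! i]) (drop (Suc i) w))"
  shows "w \<noteq> [] \<Longrightarrow> free_cumulant A \<phi> (star_word A b w) = \<kappa> w"
proof (induction "length w" arbitrary: w rule: less_induct)
  case less
  let ?n = "length w" and ?top = "{{..<length w}}"
  have len: "length (star_word A b w) = ?n" by (simp add: star_word_def)
  have V: "V \<subseteq> {..<?n}" "V \<noteq> {}" if "P \<in> NC ?n" "V \<in> P" for P V
    using nc_partition_blockD[of P "{..<?n}" V] that by (auto simp: nc_partitions_lessThan)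
  have "m w = (\<Sum>P\<in>NC ?n. \<Prod>V\<in>P. \<kappa> (nths w V))"
  proof -
    have "word_at ((!) w) {..<?n} = w" using nths_eq_word_at[of "{..<?n}" w] by simp
    then have "m w = nc_sum (\<lambda>V. \<kappa> (word_at ((!) w) V)) {..<?n}"
      using nc_sum_eqI[where m = m and f = f and \<kappa> = \<kappa>, OF m_Nil m_Cons f, of "{..<?n}" "(!) w"] by simp
    also have "\<dots> = (\<Sum>P\<in>NC ?n. \<Prod>V\<in>P. \<kappa> (nths w V))"
      unfolding nc_sum_def nc_partitions_lessThan
      by (intro sum.cong prod.cong refl) (simp add: nths_eq_word_at V)
    finally show ?thesis .
  qed
  also have "\<dots> = \<kappa> w + (\<Sum>P\<in>NC ?n - {?top}. \<Prod>V\<in>P. \<kappa> (nths w V))"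
  proof -
    have "?top \<in> NC ?n"
      using less.prems by (auto simp: NC_def noncrossing_def partition_on_def disjoint_def)
    then show ?thesis by (subst sum.remove[of _ ?top]) auto
  qed
  also have "(\<Sum>P\<in>NC ?n - {?top}. \<Prod>V\<in>P. \<kappa> (nths w V)) =
      (\<Sum>P\<in>NC ?n - {?top}. \<Prod>V\<in>P. free_cumulant A \<phi> (nths (star_word A b w) V))"
  proof (intro sum.cong prod.cong refl)
    fix P V assume PV: "P \<in> NC ?n - {?top}" "V \<in> P"
    have "nths w V \<noteq> []" using V[of P V] PV by (auto simp: nths_eq_word_at word_at_def finite_subset)
    then show "\<kappa> (nths w V) = free_cumulant A \<phi> (nths (star_word A b w) V)"
      using less.hyps[OF length_nths_less[OF PV refl]] by (simp add: star_word_def nths_map)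
  qed
  finally show ?case
    by (simp add: free_cumulant.simps[of A \<phi> "star_word A b w"] moment len)
qed

section \<open>Field operators on the full Fock space\<close>

type_synonym letter = "real \<times> bool \<times> bool"

text \<open>The letter \<open>(t, i, j)\<close> is the matrix unit \<open>e\<^sub>i\<^sub>j\<close> of the copy of the 2x2 matrices with
  index \<open>t\<close>. The three summands, as coefficients at a word, are creation of \<open>e\<^sub>i\<^sub>j\<close>, annihilation
  of its adjoint \<open>e\<^sub>j\<^sub>i\<close>, and left multiplication of the first letter by \<open>e\<^sub>i\<^sub>j\<close>. The weight
  \<open>exp t\<close> never vanishes, which makes the vacuum cyclic for the right field operators; the scalar
  \<open>(exp t)\<^sup>2 Tr e\<^sub>i\<^sub>j\<close> is dropped since it is zero for \<open>i \<noteq> j\<close>.\<close>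

fun field_coord :: "real \<Rightarrow> bool \<Rightarrow> bool \<Rightarrow> (letter list \<Rightarrow> complex) \<Rightarrow> letter list \<Rightarrow> complex" where
  "field_coord t i j F [] = of_real (exp t) * F [(t, j, i)]"
| "field_coord t i j F ((s, p, q) # w) =
    of_bool ((s, p, q) = (t, i, j)) * (of_real (exp t) * F w) + of_real (exp t) * F ((t, j, i) # (s, p, q) # w)
      + of_bool (s = t \<and> p = i) * F ((t, j, q) # w)"

fun uncons :: "letter \<Rightarrow> letter list \<Rightarrow> letter list option" where
  "uncons c [] = None"
| "uncons c (x # w) = (if x = c then Some w else None)"

fun relabel :: "real \<Rightarrow> bool \<Rightarrow> bool \<Rightarrow> letter list \<Rightarrow> letter list option" where
  "relabel t i j [] = None"
| "relabel t i j ((s, p, q) # w) = (if s = t \<and> p = i then Some ((t, j, q) # w) else None)"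

lemma partial_inverse_uncons: "partial_inverse (uncons c) (\<lambda>w. Some (c # w))"
  unfolding partial_inverse_def
proof (intro allI)
  show "uncons c x = Some y \<longleftrightarrow> Some (c # y) = Some x" for x y
    by (cases x) auto
qed

lemma partial_inverse_relabel: "partial_inverse (relabel t i j) (relabel t j i)"
  unfolding partial_inverse_def
proof (intro allI)
  show "relabel t i j x = Some y \<longleftrightarrow> relabel t j i y = Some x" for x y
    by (cases "(t, i, j, x)" rule: relabel.cases; cases "(t, j, i, y)" rule: relabel.cases) auto
qed

text \<open>Since \<open>shift\<close> moves basis vectors against its argument,
  \<open>uncons\<close> creates a letter and prepending annihilates one.\<close>

definition field_op :: "real \<Rightarrow> bool \<Rightarrow> bool \<Rightarrow> letter list ell2 \<Rightarrow>\<^sub>L letter list ell2" where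
  "field_op t i j = exp t *\<^sub>R shift (uncons (t, i, j)) + exp t *\<^sub>R shift (\<lambda>w. Some ((t, j, i) # w))
    + shift (relabel t i j)"

lemma coord_field_op: "coord (field_op t i j f) = field_coord t i j (coord f)"
proof
  note coord_shifts = coord_shift[OF partial_inverse_uncons]
    coord_shift[OF partial_inverse_sym[OF partial_inverse_uncons]] coord_shift[OF partial_inverse_relabel]
  show "coord (field_op t i j f) w = field_coord t i j (coord f) w" for w
    by (cases "(t, i, j, coord f, w)" rule: field_coord.cases)
      (simp_all add: field_op_def blinfun.add_left blinfun.scaleR_left coord_shifts pull_def)
qed

lemma adjoint_pair_field_op: "adjoint_pair (field_op t i j) (field_op t j i)"
proof -
  have "field_op t j i = exp t *\<^sub>R shift (\<lambda>w. Some ((t, i, j) # w)) + exp t *\<^sub>R shift (uncons (t, j, i))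
    + shift (relabel t j i)" by (simp add: field_op_def)
  then show ?thesis
    unfolding field_op_def[of t i j]
    by (simp only:) (intro adjoint_pair_add adjoint_pair_scaleR adjoint_pair_shift
        partial_inverse_uncons partial_inverse_relabel partial_inverse_sym[OF partial_inverse_uncons])
qed

section \<open>Right field operators and the commutation relation\<close>

definition flip_word :: "letter list \<Rightarrow> letter list" where
  "flip_word w = rev (map (\<lambda>(t, i, j). (t, j, i)) w)"

lemma flip_word_simps [simp]:
  "flip_word [] = []" "flip_word ((t, i, j) # w) = flip_word w @ [(t, j, i)]"
  "flip_word (v @ w) = flip_word w @ flip_word v" "flip_word (flip_word w) = w"
  "length (flip_word w) = length w"
  by (simp_all add: flip_word_def rev_map case_prod_unfold comp_def)

lemma partial_inverse_flip: "partial_inverse (\<lambda>w. Some (flip_word w)) (\<lambda>w. Some (flip_word w))"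
  unfolding partial_inverse_def by (metis flip_word_simps(4) option.inject)

text \<open>Reversing a word and transposing each letter is an involution. Conjugation by it makes
  the operator act on the last letter, with matrices multiplying from the right.\<close>

definition right_field_op :: "real \<Rightarrow> bool \<Rightarrow> bool \<Rightarrow> letter list ell2 \<Rightarrow>\<^sub>L letter list ell2" where
  "right_field_op t i j =
    shift (\<lambda>w. Some (flip_word w)) o\<^sub>L field_op t i j o\<^sub>L shift (\<lambda>w. Some (flip_word w))"

lemma coord_right_field_op:
  "coord (right_field_op t i j f) = (\<lambda>w. field_coord t i j (\<lambda>v. coord f (flip_word v)) (flip_word w))"
proof
  have "coord (shift (\<lambda>w. Some (flip_word w)) g) = (\<lambda>v. coord g (flip_word v))" for g
    by (simp add: coord_shift[OF partial_inverse_flip] pull_def fun_eq_iff)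
  then show "coord (right_field_op t i j f) w =
      field_coord t i j (\<lambda>v. coord f (flip_word v)) (flip_word w)" for w
    by (simp add: right_field_op_def coord_field_op)
qed

lemma adjoint_pair_right_field_op: "adjoint_pair (right_field_op t i j) (right_field_op t j i)"
  unfolding right_field_op_def
  using adjoint_pair_compose[OF adjoint_pair_compose[OF adjoint_pair_shift[OF partial_inverse_flip]
      adjoint_pair_field_op] adjoint_pair_shift[OF partial_inverse_flip]]
  by (simp add: adjoint_pair_def)

definition right_ops :: "(letter list ell2 \<Rightarrow>\<^sub>L letter list ell2) set" where
  "right_ops = range scalar \<union> {right_field_op t i j | t i j. True}"

text \<open>This compares coefficients at \<open>w\<close> of the two products of a left and a right
  operator. At words with two or more letters they act on different ends and the terms match one by
  one; the empty word and single letters, where they meet, are checked by cases on indices.\<close>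

lemma field_coord_commute:
  "field_coord t i j (\<lambda>v. field_coord s k l (\<lambda>u. F (flip_word u)) (flip_word v)) w =
   field_coord s k l (\<lambda>v. field_coord t i j F (flip_word v)) (flip_word w)"
proof -
  consider "w = []" | a p q where "w = [(a, p, q)]"
    | a p q v b p' q' where "w = (a, p, q) # v @ [(b, p', q')]"
    by (metis list.exhaust prod_cases3 rev_exhaust)
  then show ?thesis
  proof cases
    case 1
    then show ?thesis
      by (cases "t = s"; cases "i = k"; cases "j = l"; simp add: algebra_simps)
  next
    case 3
    then show ?thesis by (simp add: algebra_simps del: prod.inject)
  next
    case (2 a p q)
    then show ?thesis
      by (cases "t = s"; cases "a = t"; simp; cases i; cases j; cases k; cases l; cases p; cases q;
          simp add: algebra_simps)
  qed
qed

lemma field_coord_linear: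
  "field_coord t i j (\<lambda>s. F s + G s) w = field_coord t i j F w + field_coord t i j G w"
  "field_coord t i j (\<lambda>s. c * F s) w = c * field_coord t i j F w"
  "field_coord t i j (\<lambda>s. 0) w = 0"
  by (cases "(t, i, j, F, w)" rule: field_coord.cases; simp add: algebra_simps)+

text \<open>\<open>Abs_ell2\<close> is unspecified off the square summable functions; only injectivity matters.\<close>

definition host_enc :: "(letter list ell2 \<Rightarrow>\<^sub>L letter list ell2) \<Rightarrow> host" where
  "host_enc T = (\<lambda>h v. let \<iota> = (\<lambda>w. concat (map (\<lambda>(t, i, j). [t, of_bool i, of_bool j]) w)) in
     coord (T (Abs_ell2 (\<lambda>w. h (\<iota> w)))) (inv_into UNIV \<iota> v))"

lemma inj_host_enc: "inj host_enc"
proof (rule injI)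
  define \<iota> :: "letter list \<Rightarrow> real list"
    where "\<iota> = (\<lambda>w. concat (map (\<lambda>(t, i, j). [t, of_bool i, of_bool j]) w))"
  have inj: "inj \<iota>"
  proof (rule injI)
    show "\<iota> v = \<iota> w \<Longrightarrow> v = w" for v w
      by (induction v w rule: list_induct2') (auto simp: \<iota>_def)
  qed
  fix T S assume eq: "host_enc T = host_enc S"
  show "T = S"
  proof (intro blinfun_eqI ell2_eqI)
    fix f w
    have "(\<lambda>v. coord f (inv_into UNIV \<iota> (\<iota> v))) = coord f" by (simp add: inj)
    then show "coord (T f) w = coord (S f) w"
      using fun_cong[OF fun_cong[OF eq, of "\<lambda>v. coord f (inv_into UNIV \<iota> v)"], of "\<iota> w"] inj
      by (simp add: host_enc_def \<iota>_def[symmetric] coord_inverse)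
  qed
qed

interpretation fock: operator_algebra host_enc right_ops
proof
  show "inj host_enc" by (rule inj_host_enc)
  show "scalar c \<in> right_ops" for c by (simp add: right_ops_def)
  fix U :: "letter list ell2 \<Rightarrow>\<^sub>L letter list ell2" assume "U \<in> right_ops"
  then consider c where "U = scalar c" | t i j where "U = right_field_op t i j"
    by (auto simp: right_ops_def)
  note cases = this
  then show "U (scaleC c f) = scaleC c (U f)" for c f
    by cases (auto intro!: ell2_eqI simp: coord_right_field_op field_coord_linear)
  from cases show "\<exists>V\<in>right_ops. adjoint_pair U V"
    by cases (auto simp: right_ops_def intro: adjoint_pair_scalar adjoint_pair_right_field_op)
qed

lemma field_op_commutant: "field_op t i j \<in> commutant right_ops"
proof (rule fock.commutantI[OF adjoint_pair_field_op])
  fix U :: "letter list ell2 \<Rightarrow>\<^sub>L letter list ell2" and f assume "U \<in> right_ops"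
  then consider c where "U = scalar c" | s k l where "U = right_field_op s k l"
    by (auto simp: right_ops_def)
  then show "field_op t i j (U f) = U (field_op t i j f)"
    by cases (auto intro!: ell2_eqI simp: coord_right_field_op coord_field_op scaleC.rep_eq
        field_coord_linear field_coord_commute)
qed

text \<open>Only annihilation looks at a longer word, and its weight is positive, so the coordinate
  at that word can be recovered.\<close>

lemma field_coord_longest:
  assumes "\<And>u. length u \<le> length w \<Longrightarrow> F u = 0"
  shows "field_coord t i j F w = of_real (exp t) * F ((t, j, i) # w)"
  using assms by (cases "(t, i, j, F, w)" rule: field_coord.cases) auto

text \<open>The adjoint of \<open>T\<close> has zero coordinates at all words: the right field operators commute with
  it and append an arbitrary letter.\<close>

lemma vacuum_separating:
  assumes T: "T \<in> commutant right_ops" and vac: "T (delta []) = 0"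
  shows "T = 0"
proof -
  let ?S = "blinfun_adjoint T"
  note S = fock.adjoint_commutant[OF T]
  have Re: "Re (coord (?S g) []) = 0" for g
    using adjoint_pairD[OF adjoint_pair_sym[OF fock.adjoint_pair_adjoint[OF T]], of g "delta []"]
    by (simp add: inner_delta vac)
  \<comment> \<open>The imaginary part is the real part for the argument multiplied by
    \<open>-\<i>\<close>.\<close>
  have Nil: "coord (?S g) [] = 0" for g
    using Re[of g] Re[of "scaleC (-\<i>) g"] by (simp add: fock.commute_scaleC[OF S] complex_eq_iff)
  have "\<forall>w g. length w \<le> n \<longrightarrow> coord (?S g) w = 0" for n
  proof (induction n)
    case 0 then show ?case by (simp add: Nil)
  next
    case (Suc n)
    have "coord (?S g) w = 0" if "length w = Suc n" for w g
    proof -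
      from that obtain c v where cv: "w = v @ [c]" and v: "length v = n"
        by (auto simp: length_Suc_conv_rev)
      obtain t i j where "c = (t, i, j)" by (cases c)
      with cv have w: "w = v @ [(t, i, j)]" by simp
      \<comment> \<open>At \<open>v\<close> this operator reads the coordinate at
        \<open>v @ [(t, i, j)]\<close>; its other terms only see words of length at most
        \<open>n\<close>.\<close>
      have "right_field_op t i j \<in> right_ops" by (auto simp: right_ops_def)
      then have "coord (right_field_op t i j (?S g)) v = coord (?S (right_field_op t i j g)) v"
        using fock.commute[OF S] by simp
      also have "\<dots> = 0" using Suc v by simp
      also have "coord (right_field_op t i j (?S g)) v = of_real (exp t) * coord (?S g) w"
        unfolding coord_right_field_op using Suc v w by (subst field_coord_longest) auto
      finally show ?thesis by simp
    qed
    with Suc show ?case by (auto simp: le_Suc_eq)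
  qed
  then have "?S = 0" by (intro blinfun_eqI ell2_eqI) auto
  then show "T = 0"
    using fock.adjoint_pair_adjoint[OF T] adjoint_pair_0 by (metis adjoint_pair_sym adjoint_pair_unique)
qed

section \<open>Vacuum moments of words in the element and its adjoint\<close>

context
  fixes t lam :: real
begin

text \<open>Stated on bare coefficient functions, so that a bottom letter \<open>c\<close> can be
  split off by passing to \<open>\<lambda>s. F (s @ [c])\<close>.\<close>

definition act :: "bool list \<Rightarrow> (letter list \<Rightarrow> complex) \<Rightarrow> letter list \<Rightarrow> complex" where
  "act w = foldr (\<lambda>e F s. complex_of_real lam * field_coord t e (\<not> e) F s) w"

definition vac :: "letter list \<Rightarrow> complex" where
  "vac s = (if s = [] then 1 else 0)"

text \<open>\<open>touch c e F\<close> is the part of the operator labelled \<open>e\<close> that has \<open>c\<close> in its output and no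
  counterpart when \<open>c\<close> lies untouched at the bottom of the stack.\<close>

definition touch :: "letter \<Rightarrow> bool \<Rightarrow> (letter list \<Rightarrow> complex) \<Rightarrow> complex" where
  "touch c e F = complex_of_real lam * ((if c = (t, e, \<not> e) then complex_of_real (exp t) * F [] else 0) +
     (case c of (s, p, q) \<Rightarrow> if s = t \<and> p = e then F [(t, \<not> e, q)] else 0))"

lemma act_simps:
  "act [] F = F"
  "act (e # w) F = (\<lambda>s. complex_of_real lam * field_coord t e (\<not> e) (act w F) s)"
  by (simp_all add: act_def)

lemma act_zero: "act w (\<lambda>_. 0) = (\<lambda>_. 0)"
  by (induction w) (simp_all add: act_simps field_coord_linear)

lemma field_coord_sum:
  "finite I \<Longrightarrow> field_coord t i j (\<lambda>s. \<Sum>k\<in>I. c k * F k s) u = (\<Sum>k\<in>I. c k * field_coord t i j (F k) u)"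
  by (induction I rule: finite_induct) (simp_all add: field_coord_linear)

text \<open>The bottom letter is reachable only if nothing lies above it, that is, if
  \<open>u\<close> is empty.\<close>

lemma field_coord_append:
  "complex_of_real lam * field_coord t e (\<not> e) F (u @ [c]) =
     complex_of_real lam * field_coord t e (\<not> e) (\<lambda>s. F (s @ [c])) u + touch c e F * vac u"
proof (cases u)
  case Nil then show ?thesis by (cases c) (auto simp: touch_def vac_def algebra_simps)
next
  case (Cons x v) then show ?thesis by (cases x) (simp add: vac_def)
qed

text \<open>Either \<open>c\<close> stays untouched throughout, or \<open>w ! i\<close> is the
  leftmost operator of the word that touches it. The operators after position \<open>i\<close> have
  acted before without restriction; those before it build \<open>u\<close> above \<open>c\<close> as
  if from the vacuum.\<close>

lemma act_append:
  "act w F (u @ [c]) = act w (\<lambda>s. F (s @ [c])) u +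
     (\<Sum>i<length w. touch c (w ! i) (act (drop (Suc i) w) F) * act (take i w) vac u)"
proof (induction w arbitrary: u)
  case Nil then show ?case by (simp add: act_simps)
next
  case (Cons e w)
  have "act (e # w) F (u @ [c]) =
      complex_of_real lam * field_coord t e (\<not> e) (\<lambda>s. act w F (s @ [c])) u + touch c e (act w F) * vac u"
    by (simp only: act_simps field_coord_append)
  also have "field_coord t e (\<not> e) (\<lambda>s. act w F (s @ [c])) u =
      field_coord t e (\<not> e) (act w (\<lambda>s. F (s @ [c]))) u +
        (\<Sum>i<length w. touch c (w ! i) (act (drop (Suc i) w) F) * field_coord t e (\<not> e) (act (take i w) vac) u)"
    by (simp only: Cons.IH field_coord_linear field_coord_sum[OF finite_lessThan])
  finally show ?case
    by (simp add: sum.lessThan_Suc_shift act_simps algebra_simps sum_distrib_left del: sum.lessThan_Suc)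
qed

lemma act_vac_singleton:
  "act w vac [c] = (\<Sum>i<length w. touch c (w ! i) (act (drop (Suc i) w) vac) * act (take i w) vac [])"
proof -
  have "(\<lambda>s. vac (s @ [c])) = (\<lambda>_. 0)" by (simp add: vac_def fun_eq_iff)
  then show ?thesis using act_append[of w vac "[]" c] by (simp add: act_zero)
qed

text \<open>This is \<open>(exp t)\<^sup>2\<close> times the trace of the product of the matrix
  units, rescaled. A product of off-diagonal units is nonzero exactly for alternating words, and has
  trace one exactly if the length is even as well.\<close>

definition alternating_cumulant :: "bool list \<Rightarrow> complex" where
  "alternating_cumulant u = (if even (length u) \<and> distinct_adj u
     then (complex_of_real (exp t))\<^sup>2 * complex_of_real lam ^ length u else 0)"

text \<open>A block with entries \<open>u\<close> either ends here or waits for its next entry, in which case the letter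
  below carries the label that this entry needs and the label of the first entry.\<close>

definition open_block :: "bool list \<Rightarrow> bool list \<Rightarrow> complex" where
  "open_block u w = alternating_cumulant u * act w vac [] +
    (if distinct_adj u
     then complex_of_real lam ^ length u * complex_of_real (exp t) * act w vac [(t, \<not> last u, hd u)] else 0)"

lemma even_length_distinct_adj:
  fixes u :: "bool list"
  assumes "distinct_adj u" "u \<noteq> []"
  shows "even (length u) \<longleftrightarrow> last u \<noteq> hd u"
  using assms by (induction u rule: induct_list012) auto

text \<open>Only \<open>y = (\<not> last u)\<close> touches the awaited letter. Multiplication turns
  it into the letter awaited after \<open>y\<close>, keeping \<open>hd u\<close>. Creation fits only
  if also \<open>hd u = last u\<close>; then \<open>u @ [y]\<close> has even length, and the second
  factor \<open>exp t\<close> completes its cumulant.\<close>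

lemma touch_open_block:
  assumes "distinct_adj u" "u \<noteq> []"
  shows "complex_of_real lam ^ length u * complex_of_real (exp t) * touch (t, \<not> last u, hd u) y (act w vac) =
    open_block (u @ [y]) w"
proof -
  have "distinct_adj (u @ [y]) \<longleftrightarrow> y = (\<not> last u)"
    using assms by (auto simp: distinct_adj_append_iff)
  moreover have "even (length u) \<longleftrightarrow> last u \<noteq> hd u" by (rule even_length_distinct_adj[OF assms])
  ultimately show ?thesis using assms
    by (auto simp: touch_def open_block_def alternating_cumulant_def power2_eq_square algebra_simps)
qed

lemma open_block_rec:
  assumes "u \<noteq> []"
  shows "open_block u w = alternating_cumulant u * act w vac [] +
    (\<Sum>i<length w. act (take i w) vac [] * open_block (u @ [w ! i]) (drop (Suc i) w))"
proof (cases "distinct_adj u")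
  case True
  show ?thesis
    unfolding open_block_def[of u] act_vac_singleton[of w "(t, \<not> last u, hd u)"]
    by (simp add: True sum_distrib_left touch_open_block[OF True assms, symmetric] algebra_simps)
next
  case False
  then have "\<not> distinct_adj (u @ [y])" for y by (auto simp: distinct_adj_append_iff)
  then show ?thesis using False by (simp add: open_block_def alternating_cumulant_def)
qed

text \<open>At the empty word only annihilation contributes, and it asks for
  \<open>(t, \<not> x, x)\<close>, the letter awaited by the block \<open>[x]\<close>. The cumulant
  of a single entry is zero.\<close>

lemma act_Cons: "act (x # w) vac [] = open_block [x] w"
  by (simp add: act_simps open_block_def alternating_cumulant_def)

section \<open>The R-diagonal element and its determining sequences\<close>

definition b_op :: host where
  "b_op = host_enc (scalar (complex_of_real lam) o\<^sub>L field_op t True False)"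

lemma b_op_carrier: "b_op \<in> carrier fock.A"
  by (simp add: b_op_def fock.scalar_commutant field_op_commutant)

lemma star_word_b_op:
  "star_word fock.A b_op w = map (\<lambda>e. host_enc (scalar (complex_of_real lam) o\<^sub>L field_op t e (\<not> e))) w"
proof -
  have "star fock.A b_op = host_enc (scalar (complex_of_real lam) o\<^sub>L field_op t False True)"
    by (simp add: b_op_def fock.adjoint_scalar[OF field_op_commutant] adjoint_eqI[OF adjoint_pair_field_op])
  then show ?thesis by (auto simp: star_word_def b_op_def)
qed

lemma moment_b_op:
  "fock.vector_state [] (list_product fock.A (star_word fock.A b_op w)) = act w vac []"
proof -
  \<comment> \<open>The induction needs the whole vector obtained from the vacuum, not only its
    vacuum coefficient.\<close>
  have "\<exists>T. list_product fock.A (star_word fock.A b_op w) = host_enc T \<and> coord (T (delta [])) = act w vac"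
  proof (induction w)
    case Nil
    show ?case
      by (auto simp: star_word_def list_product_def act_simps vac_def delta.rep_eq
          intro!: exI[of _ id_blinfun])
  next
    case (Cons e w)
    then obtain T where T: "list_product fock.A (star_word fock.A b_op w) = host_enc T"
      "coord (T (delta [])) = act w vac" by blast
    have "list_product fock.A (star_word fock.A b_op (e # w)) =
        host_enc ((scalar (complex_of_real lam) o\<^sub>L field_op t e (\<not> e)) o\<^sub>L T)"
      using T(1) by (simp add: star_word_b_op list_product_def)
    moreover have "coord (((scalar (complex_of_real lam) o\<^sub>L field_op t e (\<not> e)) o\<^sub>L T) (delta [])) =
        act (e # w) vac"
      by (simp add: fun_eq_iff act_simps coord_field_op T(2))
    ultimately show ?case by blast
  qed
  then show ?thesis by auto
qed

lemma free_cumulant_b_op: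
  "w \<noteq> [] \<Longrightarrow> free_cumulant fock.A (fock.vector_state []) (star_word fock.A b_op w) =
    alternating_cumulant w"
proof (rule free_cumulant_star_word_eqI[where m = "\<lambda>w. act w vac []" and f = open_block
      and \<kappa> = alternating_cumulant])
  show "act [] vac [] = 1" by (simp add: act_simps vac_def)
qed (rule moment_b_op act_Cons open_block_rec; assumption)+

lemma R_diagonal_b_op: "R_diagonal fock.A (fock.vector_state []) b_op"
  unfolding R_diagonal_def
  by (auto simp: b_op_carrier free_cumulant_b_op alternating_cumulant_def simp del: fock.A_simps)

lemma distinct_adj_alternating: "distinct_adj (concat (replicate n [e, \<not> e]))"
proof (induction n)
  case (Suc n) then show ?case by (cases n) auto
qed simp

lemma free_cumulant_alternating:
  assumes "n \<ge> 1"
  shows "free_cumulant fock.A (fock.vector_state [])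
    (star_word fock.A b_op (concat (replicate n [e, \<not> e]))) =
      (complex_of_real (exp t))\<^sup>2 * complex_of_real lam ^ (2 * n)"
proof -
  have len: "length (concat (replicate n [e, \<not> e])) = 2 * n" by (induction n) auto
  then have "concat (replicate n [e, \<not> e]) \<noteq> []"
    using assms by (metis length_0_conv mult_eq_0_iff not_one_le_zero zero_neq_numeral)
  then show ?thesis
    unfolding free_cumulant_b_op[OF \<open>_ \<noteq> []\<close>] alternating_cumulant_def len
    by (simp add: distinct_adj_alternating)
qed

lemma alpha_beta_b_op:
  assumes "n \<ge> 1"
  shows "alpha_seq fock.A (fock.vector_state []) b_op n =
      (complex_of_real (exp t))\<^sup>2 * complex_of_real lam ^ (2 * n)"
    and "beta_seq fock.A (fock.vector_state []) b_op n =
      (complex_of_real (exp t))\<^sup>2 * complex_of_real lam ^ (2 * n)"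
  using free_cumulant_alternating[OF assms, of True] free_cumulant_alternating[OF assms, of False]
  by (simp_all add: alpha_seq_def beta_seq_def star_word_def map_concat)

end

theorem lemma4p4:
  shows "\<exists>(A :: host cstar_structure) \<phi>. cstar_probability_space A \<phi> \<and>
    (\<forall>(\<gamma>::real) (lam::real). 0 < \<gamma> \<and> 0 < lam \<longrightarrow>
      (\<exists>b\<in>carrier A. R_diagonal A \<phi> b \<and>
        (\<forall>n\<ge>1. alpha_seq A \<phi> b n = of_real (\<gamma> * lam ^ (2 * n)) \<and>
               beta_seq A \<phi> b n = of_real (\<gamma> * lam ^ (2 * n)))))"
proof (intro exI conjI allI impI)
  show "cstar_probability_space fock.A (fock.vector_state [])"
    by (rule fock.cstar_probability_space_A[OF vacuum_separating])
  fix \<gamma> lam :: real assume "0 < \<gamma> \<and> 0 < lam"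
  \<comment> \<open>The copy with index \<open>ln \<gamma> / 2\<close> has weight
    \<open>exp (ln \<gamma> / 2)\<close>, whose square is \<gamma>.\<close>
  then have "(exp (ln \<gamma> / 2))\<^sup>2 = \<gamma>" by (simp flip: exp_double)
  then have "(complex_of_real (exp (ln \<gamma> / 2)))\<^sup>2 = of_real \<gamma>" by (metis of_real_power)
  then show "\<exists>b\<in>carrier fock.A. R_diagonal fock.A (fock.vector_state []) b \<and>
        (\<forall>n\<ge>1. alpha_seq fock.A (fock.vector_state []) b n = of_real (\<gamma> * lam ^ (2 * n)) \<and>
               beta_seq fock.A (fock.vector_state []) b n = of_real (\<gamma> * lam ^ (2 * n)))"
    using b_op_carrier R_diagonal_b_op alpha_beta_b_op
    by (intro bexI[of _ "b_op (ln \<gamma> / 2) lam"]) (auto simp del: fock.A_simps)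
qed

end
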